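(* Let $\mathcal X=X_1\coprod X_2$ be a geometric $M$-poset with $\mathcal R=[2]=\{1<2\}$, and let $f:\Delta(\mathcal X)\to\mathcal X$ be the Comparison Map. If $A$ is a compact polyhedral subset of $X_1$, then the inclusion map $\Delta(\uparrow A)\hookrightarrow f^{-1}(\uparrow A)$ is a homotopy equivalence.
   Context: A topological poset is a poset $(\mathcal X,\le)$ with a Hausdorff topology on $\mathcal X$ (the Original topology) such that the order relation $\mathcal P=\{(x,y)\mid x\le y\}$ is closed in $\mathcal X\times\mathcal X$. An $M$-poset is a topological poset with a poset map (mirror) $\mu:\mathcal X\to\mathcal R$ to a finite poset $\mathcal R$ such that $x<y$ implies $\mu(x)<\mu(y)$, and every $X_r=\mu^{-1}(r)$ is a non-empty closed subset of $\mathcal X$ (so $\mathcal X$ is the topological sum of the $X_r$). For $A\subseteq\mathcal X$ let $\uparrow A=\{x\in\mathcal X\mid a\le x\text{ for some }a\in A\}$; for $A\subseteq X_r$ (or a point) let $A^{(s)}=(\uparrow A)\cap X_s$. Standing assumption (Openness Property) on all $M$-posets: if $U$ is open in $X_r$ then $\uparrow U$ is open in $\mathcal X$ (Original topology). A polyhedron is a locally compact space with a PL structure, i.e. identified with a locally finite, finite-dimensional rectilinear simplicial complex properly embedded as a closed subset of a Euclidean space, up to common rectilinear subdivision; it carries a length metric from a triangulation. A subpolyhedron (polyhedral subset) is a closed subset triangulated by a subcomplex of some triangulation in the PL structure. An $M$-poset is polyhedral if each $X_r$ is a polyhedron and $\mathcal P$ is a subpolyhedron of $\mathcal X\times\mathcal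 X$. For each $r$, $\mathcal U_r$ is a basis for the topology of $X_r$ consisting of interiors of compact neighborhoods that are PL cones on their frontiers. A compact subset $C$ of a polyhedron $D$ has trivial shape if $C$ (non-empty) can be contracted to a point in each of its neighborhoods in $D$. $cM$ is the space of non-empty compact subsets of a metric space $M$ with the Hausdorff metric. A polyhedral $M$-poset is geometric if for all $r<s$ in $\mathcal R$: (A1) for $x\in X_r$ the set $x^{(s)}$ is compact and non-empty; (A2) the map $X_r\to cX_s$, $x\mapsto x^{(s)}$, is continuous; (A3) if $U\in\mathcal U_r$ and $y\in\overline U^{(s)}$, then $\{x\in\overline U\mid x<y\}$ has trivial shape. The join $X_1*X_2$ has points $(1-t)x+ty$ ($x\in X_1,y\in X_2,0\le t\le1$; equal to $x$ when $t=0$ and to $y$ when $t=1$) with the quotient topology from $X_1\times X_2\times[0,1]$. The order complex $\Delta(\mathcal X)\subseteq X_1*X_2$ consists of $X_1$, $X_2$ and all points $(1-t)x+ty$ with $x<y$. The Comparison Map is $f(x)=x$ for $x\in X_1$ and $f((1-t)x+ty)=y$ for $t>0$. $\Delta(\uparrow A)\subseteq\Delta(\mathcal X)$ is the order complex of the sub-poset $\uparrow A$, i.e. $A$, $A^{(2)}$ and all points $(1-t)x+ty$ with $x\in A$, $y\in A^{(2)}$, $x<y$. *)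

theory Defs
  imports "HOL-Analysis.Analysis"
begin

definition homotopy_equivalence_map :: "'a topology \<Rightarrow> 'b topology \<Rightarrow> ('a \<Rightarrow> 'b) \<Rightarrow> bool" where
  "homotopy_equivalence_map X Y f \<longleftrightarrow>
     continuous_map X Y f \<and>
     (\<exists>g. continuous_map Y X g \<and>
          homotopic_with (\<lambda>_. True) X X (g \<circ> f) id \<and>
          homotopic_with (\<lambda>_. True) Y Y (f \<circ> g) id)"

text \<open>The inner existential says that the inclusion of \<open>C\<close> into \<open>N\<close> is homotopic, within \<open>N\<close>,
  to a constant map.\<close>

definition has_trivial_shape :: "'a topology \<Rightarrow> 'a set \<Rightarrow> bool" where
  "has_trivial_shape D C \<longleftrightarrow>
     compactin D C \<and> C \<noteq> {} \<and>
     (\<forall>N. N \<subseteq> topspace D \<and> C \<subseteq> D interior_of N \<longrightarrow>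
        (\<exists>a\<in>N. homotopic_with (\<lambda>_. True) (subtopology D C) (subtopology D N) id (\<lambda>_. a)))"

definition quotient_topology :: "'a topology \<Rightarrow> ('a \<Rightarrow> 'b) \<Rightarrow> 'b topology" where
  "quotient_topology X q =
     topology (\<lambda>V. V \<subseteq> q ` topspace X \<and> openin X {x \<in> topspace X. q x \<in> V})"

lemma openin_quotient_topology:
  "openin (quotient_topology X q) V \<longleftrightarrow>
     V \<subseteq> q ` topspace X \<and> openin X {x \<in> topspace X. q x \<in> V}"
proof -
  have "istopology (\<lambda>V. V \<subseteq> q ` topspace X \<and> openin X {x \<in> topspace X. q x \<in> V})"
    unfolding istopology_def
  proof (intro conjI allI impI)
    fix S T
    assume "S \<subseteq> q ` topspace X \<and> openin X {x \<in> topspace X. q x \<in> S}"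
      and "T \<subseteq> q ` topspace X \<and> openin X {x \<in> topspace X. q x \<in> T}"
    moreover have "{x \<in> topspace X. q x \<in> S \<inter> T} =
        {x \<in> topspace X. q x \<in> S} \<inter> {x \<in> topspace X. q x \<in> T}" by auto
    ultimately show "S \<inter> T \<subseteq> q ` topspace X" "openin X {x \<in> topspace X. q x \<in> S \<inter> T}"
      by (auto simp: openin_Int)
  next
    fix \<K> assume K: "\<forall>S\<in>\<K>. S \<subseteq> q ` topspace X \<and> openin X {x \<in> topspace X. q x \<in> S}"
    then show "\<Union>\<K> \<subseteq> q ` topspace X" by auto
    have "{x \<in> topspace X. q x \<in> \<Union>\<K>} = (\<Union>S\<in>\<K>. {x \<in> topspace X. q x \<in> S})" by auto
    then show "openin X {x \<in> topspace X. q x \<in> \<Union>\<K>}" using K by auto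
  qed
  then show ?thesis by (simp add: quotient_topology_def topology_inverse')
qed

text \<open>Metrics take values in \<^typ>\<open>ennreal\<close>, because a length metric is infinite between
  different path components.\<close>

definition hausdorff_dist :: "('a \<Rightarrow> 'a \<Rightarrow> ennreal) \<Rightarrow> 'a set \<Rightarrow> 'a set \<Rightarrow> ennreal" where
  "hausdorff_dist d C D = max (SUP c\<in>C. INF e\<in>D. d c e) (SUP e\<in>D. INF c\<in>C. d c e)"

text \<open>The space \<open>cM\<close> of non-empty compact subsets of \<open>M\<close>, topologised by the Hausdorff metric.\<close>

definition compact_hyperspace :: "'a topology \<Rightarrow> ('a \<Rightarrow> 'a \<Rightarrow> ennreal) \<Rightarrow> 'a set topology" where
  "compact_hyperspace M d =
     (let cM = {C. compactin M C \<and> C \<noteq> {}} in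
      topology (\<lambda>W. W \<subseteq> cM \<and>
        (\<forall>C\<in>W. \<exists>\<epsilon>>0. \<forall>D\<in>cM. hausdorff_dist d C D < \<epsilon> \<longrightarrow> D \<in> W)))"

lemma openin_compact_hyperspace:
  "openin (compact_hyperspace M d) W \<longleftrightarrow>
     W \<subseteq> {C. compactin M C \<and> C \<noteq> {}} \<and>
     (\<forall>C\<in>W. \<exists>\<epsilon>>0. \<forall>D. compactin M D \<and> D \<noteq> {} \<and> hausdorff_dist d C D < \<epsilon> \<longrightarrow> D \<in> W)"
proof -
  define cM where "cM = {C. compactin M C \<and> C \<noteq> {}}"
  define P where "P = (\<lambda>W. W \<subseteq> cM \<and>
        (\<forall>C\<in>W. \<exists>\<epsilon>>0. \<forall>D\<in>cM. hausdorff_dist d C D < \<epsilon> \<longrightarrow> D \<in> W))"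
  have "istopology P"
    unfolding istopology_def
  proof (intro conjI allI impI)
    fix S T assume S: "P S" and T: "P T"
    show "P (S \<inter> T)"
      unfolding P_def
    proof (intro conjI ballI)
      show "S \<inter> T \<subseteq> cM" using S by (auto simp: P_def)
      fix C assume C: "C \<in> S \<inter> T"
      obtain e1 where "e1 > 0" "\<forall>D\<in>cM. hausdorff_dist d C D < e1 \<longrightarrow> D \<in> S"
        using S C by (auto simp: P_def)
      moreover obtain e2 where "e2 > 0" "\<forall>D\<in>cM. hausdorff_dist d C D < e2 \<longrightarrow> D \<in> T"
        using T C by (auto simp: P_def)
      ultimately show "\<exists>\<epsilon>>0. \<forall>D\<in>cM. hausdorff_dist d C D < \<epsilon> \<longrightarrow> D \<in> S \<inter> T"
        by (intro exI[of _ "min e1 e2"]) auto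
    qed
  next
    fix \<K> assume K: "\<forall>S\<in>\<K>. P S"
    show "P (\<Union>\<K>)"
      unfolding P_def
    proof (intro conjI ballI)
      show "\<Union>\<K> \<subseteq> cM" using K by (auto simp: P_def)
      fix C assume "C \<in> \<Union>\<K>"
      then obtain S where S: "S \<in> \<K>" "C \<in> S" by auto
      then obtain e where "e > 0" "\<forall>D\<in>cM. hausdorff_dist d C D < e \<longrightarrow> D \<in> S"
        using K unfolding P_def by blast
      with S show "\<exists>\<epsilon>>0. \<forall>D\<in>cM. hausdorff_dist d C D < \<epsilon> \<longrightarrow> D \<in> \<Union>\<K>"
        by blast
    qed
  qed
  moreover have "compact_hyperspace M d = topology P"
    by (simp add: compact_hyperspace_def P_def cM_def)
  ultimately have "openin (compact_hyperspace M d) W \<longleftrightarrow> P W"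
    by (simp add: topology_inverse')
  then show ?thesis
    by (simp add: P_def cM_def imp_conjL)
qed

text \<open>The library's \<^const>\<open>simplicial_complex\<close> is a finite complex; here only local finiteness is
  required, and the underlying set has to be closed (proper embedding). As in the library, the
  empty face is a \<open>-1\<close>-simplex.\<close>

definition rectilinear_complex :: "'e::euclidean_space set set \<Rightarrow> bool" where
  "rectilinear_complex K \<longleftrightarrow>
     (\<forall>S\<in>K. \<exists>n. n simplex S) \<and>
     (\<forall>F S. S \<in> K \<and> F face_of S \<longrightarrow> F \<in> K) \<and>
     (\<forall>S S'. S \<in> K \<and> S' \<in> K \<longrightarrow> (S \<inter> S') face_of S) \<and>
     (\<forall>x\<in>\<Union>K. \<exists>V. open V \<and> x \<in> V \<and> finite {S \<in> K. S \<inter> V \<noteq> {}}) \<and>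
     closed (\<Union>K)"

text \<open>The library's \<^const>\<open>polyhedron\<close> is a different notion (a finite intersection of half-spaces).\<close>

definition pl_polyhedron :: "'e::euclidean_space set \<Rightarrow> bool" where
  "pl_polyhedron D \<longleftrightarrow> (\<exists>K. rectilinear_complex K \<and> \<Union>K = D)"

definition subpolyhedron :: "'e::euclidean_space set \<Rightarrow> 'e set \<Rightarrow> bool" where
  "subpolyhedron D S \<longleftrightarrow>
     (\<exists>K L. rectilinear_complex K \<and> \<Union>K = D \<and> rectilinear_complex L \<and> L \<subseteq> K \<and> \<Union>L = S)"

definition pl_homeomorphism ::
    "'e::euclidean_space set \<Rightarrow> 'f::euclidean_space set \<Rightarrow> ('e \<Rightarrow> 'f) \<Rightarrow> bool" where
  "pl_homeomorphism S T h \<longleftrightarrow>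
     homeomorphic_map (top_of_set S) (top_of_set T) h \<and>
     (\<exists>K. rectilinear_complex K \<and> \<Union>K = S \<and>
          (\<forall>\<sigma>\<in>K. \<exists>l c. linear l \<and> (\<forall>x\<in>\<sigma>. h x = l x + c)))"

text \<open>The cone on \<open>F\<close>, with base \<open>F \<times> {0}\<close> and apex \<open>(0, 1)\<close>; the cone on the empty set is a point.\<close>

definition pl_cone :: "'e::euclidean_space set \<Rightarrow> ('e \<times> real) set" where
  "pl_cone F = insert (0, 1) {((1 - t) *\<^sub>R x, t) | x t. x \<in> F \<and> 0 \<le> t \<and> t \<le> 1}"

definition is_pl_cone_on :: "'e::euclidean_space set \<Rightarrow> 'e set \<Rightarrow> bool" where
  "is_pl_cone_on N F \<longleftrightarrow>
     (\<exists>h. pl_homeomorphism (pl_cone F) N h \<and> (\<forall>x\<in>F. h (x, 0) = x))"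

text \<open>The length metric for the Euclidean metric on the simplices of a rectilinear triangulation of
  \<open>D\<close>: the infimum of the lengths of polygonal paths in \<open>D\<close> (the value is \<open>\<infinity>\<close> if there are none).\<close>

definition length_dist :: "'e::euclidean_space set \<Rightarrow> 'e \<Rightarrow> 'e \<Rightarrow> ennreal" where
  "length_dist D x y =
     Inf {(\<Sum>i<length p - 1. ennreal (dist (p ! i) (p ! Suc i))) | p.
            p \<noteq> [] \<and> hd p = x \<and> last p = y \<and>
            (\<forall>i<length p - 1. closed_segment (p ! i) (p ! Suc i) \<subseteq> D)}"

text \<open>The order on \<^term>\<open>topspace X\<close> is given by its graph \<open>P = {(x, y). x \<le> y}\<close>, so that
  \<open>P `` A\<close> is the up-set of \<open>A\<close>.\<close>

locale topological_poset =
  fixes X :: "'a topology" and P :: "'a rel"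
  assumes Hausdorff: "Hausdorff_space X"
    and order: "partial_order_on (topspace X) P"
    and closed_order: "closedin (prod_topology X X) P"

abbreviation upset :: "'a rel \<Rightarrow> 'a set \<Rightarrow> 'a set" where
  "upset P A \<equiv> P `` A"

definition stratum :: "'a topology \<Rightarrow> ('a \<Rightarrow> 'r) \<Rightarrow> 'r \<Rightarrow> 'a set" where
  "stratum X \<mu> r = {x \<in> topspace X. \<mu> x = r}"

abbreviation stratum_space :: "'a topology \<Rightarrow> ('a \<Rightarrow> 'r) \<Rightarrow> 'r \<Rightarrow> 'a topology" where
  "stratum_space X \<mu> r \<equiv> subtopology X (stratum X \<mu> r)"

definition upset_in :: "'a topology \<Rightarrow> 'a rel \<Rightarrow> ('a \<Rightarrow> 'r) \<Rightarrow> 'r \<Rightarrow> 'a set \<Rightarrow> 'a set" where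
  "upset_in X P \<mu> s A = upset P A \<inter> stratum X \<mu> s"

text \<open>\<open>R\<close> is a finite poset, with the order induced from its ambient type.\<close>

locale M_poset = topological_poset X P
  for X :: "'a topology" and P :: "'a rel" +
  fixes R :: "'r::order set" and \<mu> :: "'a \<Rightarrow> 'r"
  assumes finite_R: "finite R"
    and mirror_in: "\<And>x. x \<in> topspace X \<Longrightarrow> \<mu> x \<in> R"
    and mirror_mono: "\<And>x y. (x, y) \<in> P \<Longrightarrow> \<mu> x \<le> \<mu> y"
    and mirror_strict: "\<And>x y. (x, y) \<in> P \<Longrightarrow> x \<noteq> y \<Longrightarrow> \<mu> x < \<mu> y"
    and stratum_nonempty: "\<And>r. r \<in> R \<Longrightarrow> stratum X \<mu> r \<noteq> {}"
    and stratum_closed: "\<And>r. r \<in> R \<Longrightarrow> closedin X (stratum X \<mu> r)"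
    and openness:
      "\<And>r U. r \<in> R \<Longrightarrow> openin (stratum_space X \<mu> r) U \<Longrightarrow> openin X (upset P U)"

text \<open>The PL structures on the strata are represented by a closed embedding \<open>\<phi>\<close> of their topological
  sum \<open>X\<close> in one Euclidean space; finitely many polyhedra always admit such a common
  embedding. The product \<open>X \<times> X\<close> carries the PL structure given by \<open>\<phi> \<times> \<phi>\<close>.\<close>

locale polyhedral_M_poset = M_poset X P R \<mu>
  for X :: "'a topology" and P :: "'a rel" and R :: "'r::order set" and \<mu> :: "'a \<Rightarrow> 'r" +
  fixes \<phi> :: "'a \<Rightarrow> 'e::euclidean_space"
  assumes embedding: "embedding_map X euclidean \<phi>"
    and stratum_polyhedron: "\<And>r. r \<in> R \<Longrightarrow> pl_polyhedron (\<phi> ` stratum X \<mu> r)"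
    and order_subpolyhedron:
      "subpolyhedron (map_prod \<phi> \<phi> ` (topspace X \<times> topspace X)) (map_prod \<phi> \<phi> ` P)"

text \<open>\<open>\<U> r\<close> may be any basis of the required kind.\<close>

locale geometric_M_poset = polyhedral_M_poset X P R \<mu> \<phi>
  for X :: "'a topology" and P :: "'a rel" and R :: "'r::order set" and \<mu> :: "'a \<Rightarrow> 'r"
    and \<phi> :: "'a \<Rightarrow> 'e::euclidean_space" +
  fixes \<U> :: "'r \<Rightarrow> 'a set set"
  assumes basis:
      "\<And>r. r \<in> R \<Longrightarrow> openin (stratum_space X \<mu> r) = arbitrary union_of (\<lambda>U. U \<in> \<U> r)"
    and basis_cone:
      "\<And>r U. r \<in> R \<Longrightarrow> U \<in> \<U> r \<Longrightarrow>
        \<exists>N. compactin (stratum_space X \<mu> r) N \<and> U = stratum_space X \<mu> r interior_of N \<and>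
            is_pl_cone_on (\<phi> ` N) (\<phi> ` (stratum_space X \<mu> r frontier_of N))"
    and A1:
      "\<And>r s x. r \<in> R \<Longrightarrow> s \<in> R \<Longrightarrow> r < s \<Longrightarrow> x \<in> stratum X \<mu> r \<Longrightarrow>
        compactin (stratum_space X \<mu> s) (upset_in X P \<mu> s {x}) \<and> upset_in X P \<mu> s {x} \<noteq> {}"
    and A2:
      "\<And>r s. r \<in> R \<Longrightarrow> s \<in> R \<Longrightarrow> r < s \<Longrightarrow>
        continuous_map (stratum_space X \<mu> r)
          (compact_hyperspace (stratum_space X \<mu> s)
             (\<lambda>y z. length_dist (\<phi> ` stratum X \<mu> s) (\<phi> y) (\<phi> z)))
          (\<lambda>x. upset_in X P \<mu> s {x})"
    and A3:
      "\<And>r s U y. r \<in> R \<Longrightarrow> s \<in> R \<Longrightarrow> r < s \<Longrightarrow> U \<in> \<U> r \<Longrightarrow>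
        y \<in> upset_in X P \<mu> s (stratum_space X \<mu> r closure_of U) \<Longrightarrow>
        has_trivial_shape (stratum_space X \<mu> r)
          {x \<in> stratum_space X \<mu> r closure_of U. (x, y) \<in> P \<and> x \<noteq> y}"

text \<open>\<^term>\<open>Inner x y t\<close>, with \<open>0 < t < 1\<close>, is the point \<open>(1 - t) x + t y\<close>. The values of
  \<open>join_point\<close> at \<open>t = 0\<close> and \<open>t = 1\<close> realise the identifications with \<open>x\<close> and \<open>y\<close>.\<close>

datatype 'a join = End1 'a | End2 'a | Inner 'a 'a real

definition join_point :: "'a \<Rightarrow> 'a \<Rightarrow> real \<Rightarrow> 'a join" where
  "join_point x y t = (if t = 0 then End1 x else if t = 1 then End2 y else Inner x y t)"

definition join_topology :: "'a topology \<Rightarrow> 'a topology \<Rightarrow> 'a join topology" where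
  "join_topology X1 X2 =
     quotient_topology (prod_topology X1 (prod_topology X2 (top_of_set {0..1}))) 
       (\<lambda>(x, y, t). join_point x y t)"

text \<open>The order complex of the sub-poset \<open>Y\<close>, for a mirror with values in \<open>{1, 2}\<close>.\<close>

definition order_complex :: "'a topology \<Rightarrow> 'a rel \<Rightarrow> ('a \<Rightarrow> nat) \<Rightarrow> 'a set \<Rightarrow> 'a join set" where
  "order_complex X P \<mu> Y =
     End1 ` (Y \<inter> stratum X \<mu> 1) \<union> End2 ` (Y \<inter> stratum X \<mu> 2) \<union>
     {join_point x y t | x y t.
        x \<in> Y \<inter> stratum X \<mu> 1 \<and> y \<in> Y \<inter> stratum X \<mu> 2 \<and> (x, y) \<in> P \<and> x \<noteq> y \<and> 0 \<le> t \<and> t \<le> 1}"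

definition order_complex_space :: "'a topology \<Rightarrow> 'a rel \<Rightarrow> ('a \<Rightarrow> nat) \<Rightarrow> 'a join topology" where
  "order_complex_space X P \<mu> =
     subtopology (join_topology (stratum_space X \<mu> 1) (stratum_space X \<mu> 2))
       (order_complex X P \<mu> (topspace X))"

fun comparison_map :: "'a join \<Rightarrow> 'a" where
  "comparison_map (End1 x) = x"
| "comparison_map (End2 y) = y"
| "comparison_map (Inner x y t) = y"

definition comparison_preimage ::
    "'a topology \<Rightarrow> 'a rel \<Rightarrow> ('a \<Rightarrow> nat) \<Rightarrow> 'a set \<Rightarrow> 'a join set" where
  "comparison_preimage X P \<mu> B =
     {p \<in> order_complex X P \<mu> (topspace X). comparison_map p \<in> B}"

end

theory Submission
  imports Defs
begin

text \<open>Let \<open>E\<close> be the graph of the order between the two strata, \<open>B\<close> the part of the up-set of \<open>A\<close> in the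
  second stratum, \<open>Q\<close> the pairs in \<open>E\<close> with second entry in \<open>B\<close>, and \<open>T\<close> the pairs in \<open>E\<close> with first entry
  in \<open>A\<close>. By (A1) and (A2) the set \<open>T\<close> is compact, and near \<open>T\<close> both \<open>Q\<close> and \<open>T\<close> are finite unions of
  compact convex sets, hence Euclidean neighbourhood retracts. So there is a deformation \<open>D\<close> of \<open>Q\<close>,
  stationary on \<open>T\<close>, which moves a neighbourhood \<open>l < 1/2\<close> of \<open>T\<close> into \<open>T\<close>, where \<open>l\<close> vanishes on \<open>T\<close>.
  A point \<open>(1 - t) x + t y\<close> of the preimage is pushed along the join parameter to
  \<open>min 1 (2 max t (l (x, y)))\<close> while \<open>(x, y)\<close> is moved by \<open>D\<close>: points over pairs far from \<open>T\<close> end in \<open>B\<close>, the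
  others end over \<open>T\<close>. Upper semicontinuity of the fibres gives continuity at the points of \<open>A\<close>;
  away from \<open>A\<close> the preimage carries the quotient topology from \<open>Q\<close> times \<open>(0, 1]\<close>.\<close>

subsection \<open>Deformation into a compact neighbourhood retract\<close>

text \<open>Straight segments turn the retraction \<open>r\<close> onto \<open>T\<close> into a
  homotopy, the retraction \<open>\<rho>\<close> onto \<open>Q'\<close> brings them back into
  \<open>Q\<close>, and a cutoff blends the result into the identity away from \<open>T\<close>. The
  set \<open>Q'\<close> is there because \<open>Q\<close> may be noncompact: the ENR property is
  asked for only near \<open>T\<close>.\<close>

lemma deformation_into_compact_ENR:
  fixes Q T :: "'e::euclidean_space set"
  assumes T: "compact T" "ENR T" "T \<subseteq> Q"
    and Q': "ENR Q'" "Q' \<subseteq> Q" and W: "open W" "T \<subseteq> W" "Q \<inter> W \<subseteq> Q'"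
  obtains D :: "'e \<times> real \<Rightarrow> 'e" and l :: "'e \<Rightarrow> real"
  where "continuous_on (Q \<times> {0..1}) D" and "D \<in> Q \<times> {0..1} \<rightarrow> Q"
    and "\<And>z. z \<in> Q \<Longrightarrow> D (z, 0) = z"
    and "\<And>z s. z \<in> T \<Longrightarrow> s \<in> {0..1} \<Longrightarrow> D (z, s) = z"
    and "continuous_on Q l" and "l \<in> Q \<rightarrow> {0..1}" and "\<And>z. z \<in> T \<Longrightarrow> l z = 0"
    and "\<And>z. z \<in> Q \<Longrightarrow> l z < 1 / 2 \<Longrightarrow> D (z, 1) \<in> T"
proof (cases "T = {}")
  case True
  \<comment> \<open>\<open>infdist z {}\<close> is 0 by convention, so this case gets its own
    \<open>l\<close>; the constant 1 makes the last condition vacuous.\<close>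
  show ?thesis
    by (rule that[of fst "\<lambda>_. 1"]) (use True in \<open>auto intro!: continuous_intros\<close>)
next
  case False
  obtain U \<rho> where U: "open U" "Q' \<subseteq> U" and \<rho>: "continuous_on U \<rho>" "\<rho> \<in> U \<rightarrow> Q'" "\<And>x. x \<in> Q' \<Longrightarrow> \<rho> x = x"
    using Q' by (auto simp: ENR_def retract_of_def retraction_def)
  obtain V r where V: "open V" "T \<subseteq> V" and r: "continuous_on V r" "r \<in> V \<rightarrow> T" "\<And>x. x \<in> T \<Longrightarrow> r x = x"
    using T by (auto simp: ENR_def retract_of_def retraction_def)
  have "T \<subseteq> U" using W T U by blast
  then obtain \<epsilon> where \<epsilon>: "\<epsilon> > 0" "(\<Union>x\<in>T. ball x \<epsilon>) \<subseteq> U"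
    using compact_subset_open_imp_ball_epsilon_subset[OF T(1) U(1)] by metis
  \<comment> \<open>On \<open>V1\<close> the segment from \<open>z\<close> to \<open>r z\<close>
    stays in the \<open>\<epsilon>\<close>-ball about the point \<open>r z\<close> of
    \<open>T\<close>, hence in the domain \<open>U\<close> of \<open>\<rho>\<close>.\<close>
  define V1 where "V1 = {z \<in> V \<inter> W. dist z (r z) < \<epsilon>}"
  have "open V1"
  proof -
    have "continuous_on (V \<inter> W) (\<lambda>z. dist z (r z))"
      using r(1) by (auto intro!: continuous_intros intro: continuous_on_subset)
    moreover have "V1 = (V \<inter> W) \<inter> (\<lambda>z. dist z (r z)) -` {..<\<epsilon>}" by (auto simp: V1_def)
    ultimately show ?thesis
      using V(1) W(1) continuous_open_preimage open_lessThan by (metis open_Int)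
  qed
  moreover have "T \<subseteq> V1" using V W r \<epsilon> by (auto simp: V1_def)
  ultimately obtain \<delta> where \<delta>: "\<delta> > 0" "{x. infdist x T \<le> \<delta>} \<subseteq> V1"
    using compact_in_open_separated[OF False T(1)] by metis
  \<comment> \<open>Distance to \<open>T\<close> in units of \<open>\<delta>\<close>, so that
    \<open>e \<le> 1\<close> forces \<open>z \<in> V1\<close>.\<close>
  define e where "e = (\<lambda>z. infdist z T / \<delta>)"
  have e: "continuous_on S e" for S unfolding e_def using \<delta>
    by (intro continuous_intros) auto
  have e0: "e z = 0" if "z \<in> T" for z using that by (simp add: e_def)
  have e_pos: "e z \<ge> 0" for z using \<delta> by (simp add: e_def infdist_nonneg)
  have eV: "z \<in> V1" if "e z \<le> 1" for z
    using that \<delta> by (auto simp: e_def divide_simps)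
  \<comment> \<open>The cutoff is 1 where \<open>e \<le> 1/2\<close>, so that
    \<open>seg (z, 1) = r z\<close> there, and 0 where \<open>e \<ge> 1\<close>.\<close>
  define c where "c = (\<lambda>z. max 0 (min 1 (2 - 2 * e z)))"
  have c: "continuous_on S c" for S unfolding c_def by (intro continuous_intros e)
  have c01: "0 \<le> c z" "c z \<le> 1" for z by (auto simp: c_def)
  define seg where "seg = (\<lambda>(z, s). (1 - s * c z) *\<^sub>R z + (s * c z) *\<^sub>R r z)"
  define N where "N = {z \<in> Q. e z \<le> 1} \<times> {0..1::real}"
  have segU: "seg p \<in> U" if "p \<in> N" for p
  proof -
    obtain z s where p: "p = (z, s)" "z \<in> Q" "e z \<le> 1" "0 \<le> s" "s \<le> 1"
      using \<open>p \<in> N\<close> by (auto simp: N_def)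
    have z: "z \<in> V1" using eV p by auto
    have u: "0 \<le> s * c z" "s * c z \<le> 1" using c01[of z] p by (auto simp: mult_le_one)
    have "dist (r z) (seg p) = (1 - s * c z) * dist z (r z)"
    proof -
      have "r z - seg p = (1 - s * c z) *\<^sub>R (r z - z)"
        by (simp add: p seg_def algebra_simps)
      then show ?thesis using u by (simp add: dist_norm norm_minus_commute)
    qed
    also have "\<dots> \<le> 1 * dist z (r z)" using u by (intro mult_right_mono) auto
    also have "\<dots> < \<epsilon>" using z by (auto simp: V1_def)
    finally have "seg p \<in> ball (r z) \<epsilon>" by simp
    moreover have "r z \<in> T" using r z by (auto simp: V1_def)
    ultimately show ?thesis using \<epsilon> by blast
  qed
  have cseg: "continuous_on N seg"
  proof -
    have fN: "continuous_on N (\<lambda>p. r (fst p))"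
      by (rule continuous_on_compose2[OF r(1)]) (auto intro!: continuous_intros simp: N_def V1_def dest: eV)
    have "continuous_on N (\<lambda>p. c (fst p))"
      by (rule continuous_on_compose2[OF c[of UNIV]]) (auto intro!: continuous_intros)
    then show ?thesis unfolding seg_def case_prod_beta
      by (intro continuous_intros fN)
  qed
  \<comment> \<open>On \<open>e = 1\<close> the cutoff vanishes and \<open>\<rho>\<close> fixes
    \<open>z \<in> Q'\<close>, so the two branches agree and glue along closed sets.\<close>
  define D where "D = (\<lambda>p. if e (fst p) \<le> 1 then \<rho> (seg p) else fst p)"
  have zQ': "z \<in> Q'" if "z \<in> Q" "e z \<le> 1" for z
    using eV[OF that(2)] that W by (auto simp: V1_def)
  show ?thesis
  proof (rule that[of D "\<lambda>z. min 1 (e z)"])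
    have "continuous_on (N \<union> {z \<in> Q. e z \<ge> 1} \<times> {0..1}) (\<lambda>p. if e (fst p) \<le> 1 then \<rho> (seg p) else fst p)"
    proof (rule continuous_on_cases_local)
      have ef: "continuous_on UNIV (\<lambda>p. e (fst p))"
        by (rule continuous_on_compose2[OF e[of UNIV]]) (auto intro!: continuous_intros)
      have cl: "closed {p::'e \<times> real. e (fst p) \<le> 1}" "closed {p::'e \<times> real. 1 \<le> e (fst p)}"
        by (auto intro!: closed_Collect_le ef continuous_intros)
      show "closedin (top_of_set (N \<union> {z \<in> Q. 1 \<le> e z} \<times> {0..1})) N"
        unfolding closedin_closed
        by (rule exI[of _ "{p. e (fst p) \<le> 1}"]) (use cl in \<open>auto simp: N_def\<close>)
      show "closedin (top_of_set (N \<union> {z \<in> Q. 1 \<le> e z} \<times> {0..1})) ({z \<in> Q. 1 \<le> e z} \<times> {0..1})"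
        unfolding closedin_closed
        by (rule exI[of _ "{p. 1 \<le> e (fst p)}"]) (use cl in \<open>auto simp: N_def\<close>)
      show "continuous_on N (\<lambda>p. \<rho> (seg p))"
        by (rule continuous_on_compose2[OF \<rho>(1) cseg]) (use segU in auto)
      show "continuous_on ({z \<in> Q. 1 \<le> e z} \<times> {0..1}) fst" by (intro continuous_intros)
      fix p assume p: "p \<in> N \<and> \<not> e (fst p) \<le> 1 \<or> p \<in> {z \<in> Q. 1 \<le> e z} \<times> {0..1} \<and> e (fst p) \<le> 1"
      then have "fst p \<in> Q" "e (fst p) = 1" by (auto simp: N_def)
      then show "\<rho> (seg p) = fst p"
        using zQ'[of "fst p"] \<rho>(3) by (simp add: seg_def c_def case_prod_beta)
    qed
    moreover have "N \<union> {z \<in> Q. e z \<ge> 1} \<times> {0..1} = Q \<times> {0..1}" by (auto simp: N_def)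
    ultimately show "continuous_on (Q \<times> {0..1}) D" by (simp add: D_def)
    show "D \<in> Q \<times> {0..1} \<rightarrow> Q"
      using segU \<rho>(2) Q'(2) by (fastforce simp: D_def N_def)
    show "D (z, 0) = z" if "z \<in> Q" for z
      using zQ' \<rho>(3) that by (auto simp: D_def seg_def)
    show "D (z, s) = z" if "z \<in> T" "s \<in> {0..1}" for z s
    proof -
      have "z \<in> Q" "e z = 0" "r z = z" using that T e0 r by auto
      then show ?thesis using zQ'[of z] \<rho>(3) by (simp add: D_def seg_def flip: scaleR_left_distrib)
    qed
    show "continuous_on Q (\<lambda>z. min 1 (e z))" by (intro continuous_intros e)
    show "(\<lambda>z. min 1 (e z)) \<in> Q \<rightarrow> {0..1}" using e_pos by auto
    show "min 1 (e z) = 0" if "z \<in> T" for z using e0[OF that] by simp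
    show "D (z, 1) \<in> T" if "z \<in> Q" "min 1 (e z) < 1 / 2" for z
    proof -
      have "e z < 1 / 2" using that by auto
      then have "c z = 1" "z \<in> V1" using eV[of z] by (auto simp: c_def)
      then have "D (z, 1) = \<rho> (r z)" "r z \<in> T"
        using \<open>e z < 1/2\<close> r by (auto simp: D_def seg_def V1_def)
      then show ?thesis using \<rho>(3) T W by force
    qed
  qed
qed

subsection \<open>Homotopies on the join\<close>

text \<open>The time-one map of \<open>G\<close> is a homotopy inverse. Both composites with the
  inclusion are this map again, on \<open>S\<close> and on \<open>W\<close>, and \<open>G\<close>
  joins it to the identity on each, because it leaves both sets invariant. Points of
  \<open>S\<close> may move within \<open>S\<close>.\<close>

lemma homotopy_equivalence_map_weak_deformation:
  assumes S: "S \<subseteq> W"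
    and G: "continuous_map (prod_topology (top_of_set {0..1::real}) (subtopology J W)) (subtopology J W) G"
    and G0: "\<And>x. x \<in> W \<Longrightarrow> G (0, x) = x"
    and GS: "\<And>s x. s \<in> {0..1} \<Longrightarrow> x \<in> S \<Longrightarrow> G (s, x) \<in> S"
    and G1: "\<And>x. x \<in> W \<Longrightarrow> G (1, x) \<in> S"
  shows "homotopy_equivalence_map (subtopology J S) (subtopology J W) id"
proof -
  define g where "g x = G (1, x)" for x
  have [simp]: "subtopology (subtopology J W) S = subtopology J S"
    using S by (simp add: subtopology_subtopology Int_absorb1)
  have W: "homotopic_with (\<lambda>_. True) (subtopology J W) (subtopology J W) id g"
    using G G0 by (subst homotopic_with) (auto simp: g_def intro!: exI[of _ G])
  have "continuous_map (prod_topology (top_of_set {0..1::real}) (subtopology J S)) (subtopology J S) G"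
  proof -
    have "continuous_map (subtopology (prod_topology (top_of_set {0..1::real}) (subtopology J W)) (UNIV \<times> S))
        (subtopology (subtopology J W) S) G"
      by (rule continuous_map_into_subtopology[OF continuous_map_from_subtopology[OF G]])
        (auto intro: GS)
    then show ?thesis by (simp add: subtopology_Times)
  qed
  then have S: "homotopic_with (\<lambda>_. True) (subtopology J S) (subtopology J S) id g"
    using G0 S by (subst homotopic_with) (auto simp: g_def intro!: exI[of _ G])
  have g: "continuous_map (subtopology J W) (subtopology J S) g"
  proof -
    have "continuous_map (subtopology J W) (subtopology J W) g"
      using W homotopic_with_imp_continuous_maps by blast
    then have "continuous_map (subtopology J W) (subtopology (subtopology J W) S) g"
      by (rule continuous_map_into_subtopology) (auto simp: g_def G1)
    then show ?thesis by simp
  qed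
  show ?thesis
    unfolding homotopy_equivalence_map_def
  proof (intro conjI exI[of _ g] g)
    show "continuous_map (subtopology J S) (subtopology J W) id"
      unfolding id_def using assms(1) by (intro continuous_map_into_subtopology continuous_map_from_subtopology) auto
    show "homotopic_with (\<lambda>_. True) (subtopology J S) (subtopology J S) (g \<circ> id) id"
      "homotopic_with (\<lambda>_. True) (subtopology J W) (subtopology J W) (id \<circ> g) id"
      using S W by (simp_all add: homotopic_with_symD)
  qed
qed

section \<open>The join as a quotient space\<close>

lemma quotient_map_quotient_topology: "quotient_map X (quotient_topology X q) q"
proof -
  have "topspace (quotient_topology X q) = q ` topspace X"
  proof -
    have "openin (quotient_topology X q) (q ` topspace X)"
      by (auto simp: openin_quotient_topology cong: conj_cong)
    then show ?thesis
      using openin_quotient_topology[of X q "topspace (quotient_topology X q)"] openin_subset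
      by blast
  qed
  then show ?thesis by (simp add: quotient_map_def openin_quotient_topology)
qed

text \<open>The pair is grouped apart from the parameter, so that a point of the graph is a single
  argument of the deformation.\<close>

definition join_map :: "('a \<times> 'a) \<times> real \<Rightarrow> 'a join" where
  "join_map p = join_point (fst (fst p)) (snd (fst p)) (snd p)"

text \<open>Regrouping the factors is a homeomorphism, and composing it with the defining quotient
  map gives a quotient map.\<close>

lemma quotient_map_join_map:
  "quotient_map (prod_topology (prod_topology X1 X2) (top_of_set {0..1})) (join_topology X1 X2) join_map"
proof -
  let ?I = "top_of_set {0..1::real}"
  let ?f = "\<lambda>((x, y), t). (x, (y, t))" and ?g = "\<lambda>(x, (y, t)). ((x, y), t)"
  have "homeomorphic_maps (prod_topology (prod_topology X1 X2) ?I) (prod_topology X1 (prod_topology X2 ?I)) ?f ?g"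
  proof -
    note c = continuous_map_compose[unfolded o_def]
    have "continuous_map (prod_topology (prod_topology X1 X2) ?I) (prod_topology X1 (prod_topology X2 ?I)) ?f"
      unfolding continuous_map_pairwise o_def case_prod_unfold fst_conv snd_conv
      by (intro conjI continuous_map_snd c[OF continuous_map_fst continuous_map_fst] c[OF continuous_map_fst continuous_map_snd])
    moreover have "continuous_map (prod_topology X1 (prod_topology X2 ?I)) (prod_topology (prod_topology X1 X2) ?I) ?g"
      unfolding continuous_map_pairwise o_def case_prod_unfold fst_conv snd_conv
      by (intro conjI continuous_map_fst c[OF continuous_map_snd continuous_map_snd] c[OF continuous_map_snd continuous_map_fst])
    ultimately show ?thesis by (auto simp: homeomorphic_maps_def)
  qed
  then have "quotient_map (prod_topology (prod_topology X1 X2) ?I) (prod_topology X1 (prod_topology X2 ?I)) ?f"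
    using homeomorphic_maps_imp_map homeomorphic_map_def by blast
  from quotient_map_compose[OF this quotient_map_quotient_topology[of _ "\<lambda>(x, y, t). join_point x y t"]]
  show ?thesis
    by (simp add: join_topology_def comp_def case_prod_unfold join_map_def[abs_def])
qed

lemma join_point_in_topspace_join:
  "x \<in> topspace X1 \<Longrightarrow> y \<in> topspace X2 \<Longrightarrow> 0 \<le> t \<Longrightarrow> t \<le> 1 \<Longrightarrow>
    join_point x y t \<in> topspace (join_topology X1 X2)"
  unfolding quotient_imp_surjective_map[OF quotient_map_join_map[of X1 X2], symmetric]
  by (rule image_eqI[of _ _ "((x, y), t)"]) (simp_all add: join_map_def)

lemma openin_join_topology:
  "openin (join_topology X1 X2) V \<longleftrightarrow> V \<subseteq> topspace (join_topology X1 X2) \<and>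
    openin (prod_topology (prod_topology X1 X2) (top_of_set {0..1}))
      {p \<in> (topspace X1 \<times> topspace X2) \<times> {0..1}. join_map p \<in> V}"
proof -
  have "openin (join_topology X1 X2) V \<longleftrightarrow> V \<subseteq> topspace (join_topology X1 X2) \<and>
      openin (prod_topology (prod_topology X1 X2) (top_of_set {0..1}))
        {p \<in> topspace (prod_topology (prod_topology X1 X2) (top_of_set {0..1::real})). join_map p \<in> V}"
  proof (cases "V \<subseteq> topspace (join_topology X1 X2)")
    case True
    then show ?thesis
      using quotient_map_join_map[of X1 X2, unfolded quotient_map_def, THEN conjunct2, rule_format, OF True] by simp
  next
    case False
    then show ?thesis using openin_subset[of _ V] by blast
  qed
  then show ?thesis by simp
qed

section \<open>The push along the join parameter\<close>

text \<open>The topological data behind the push: \<open>E\<close> is the graph of the order between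
  the strata, \<open>fibre_usc\<close> is upper semicontinuity of its fibres, and \<open>l\<close>
  measures how far a pair of \<open>Q\<close> is from \<open>T\<close>.\<close>

locale join_deformation =
  fixes X1 X2 :: "'a topology" and E :: "'a rel" and A :: "'a set"
    and D :: "('a \<times> 'a) \<times> real \<Rightarrow> 'a \<times> 'a" and l :: "'a \<times> 'a \<Rightarrow> real"
    and B Q T defines "B \<equiv> E `` A" and "Q \<equiv> E \<inter> UNIV \<times> B" and "T \<equiv> E \<inter> A \<times> UNIV"
  assumes Hausdorff_X2: "Hausdorff_space X2"
    and closed_E: "closedin (prod_topology X1 X2) E"
    and A_subset: "A \<subseteq> topspace X1"
    and fibre_compact: "\<And>x. x \<in> topspace X1 \<Longrightarrow> compactin X2 (E `` {x})"
    and fibre_nonempty: "\<And>x. x \<in> topspace X1 \<Longrightarrow> E `` {x} \<noteq> {}"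
    and fibre_usc: "\<And>V. openin X2 V \<Longrightarrow> openin X1 {x \<in> topspace X1. E `` {x} \<subseteq> V}"
    and compact_T: "compactin (prod_topology X1 X2) T"
    and D: "continuous_map (prod_topology (subtopology (prod_topology X1 X2) Q) (top_of_set {0..1}))
        (subtopology (prod_topology X1 X2) Q) D"
    and D_0: "\<And>z. z \<in> Q \<Longrightarrow> D (z, 0) = z"
    and D_T: "\<And>z s. z \<in> T \<Longrightarrow> s \<in> {0..1} \<Longrightarrow> D (z, s) = z"
    and l: "continuous_map (subtopology (prod_topology X1 X2) Q) euclideanreal l"
    and l_range: "\<And>z. z \<in> Q \<Longrightarrow> l z \<in> {0..1}"
    and l_T: "\<And>z. z \<in> T \<Longrightarrow> l z = 0"
    and D_1: "\<And>z. z \<in> Q \<Longrightarrow> l z < 1 / 2 \<Longrightarrow> D (z, 1) \<in> T"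
begin

abbreviation "J \<equiv> join_topology X1 X2"
abbreviation "TQ \<equiv> subtopology (prod_topology X1 X2) Q"
abbreviation "I \<equiv> top_of_set {0..1::real}"

text \<open>In the notation of the paper \<open>S\<close> is the order complex of the up-set of \<open>A\<close>, \<open>W\<close> is the preimage of
  the up-set under the comparison map, and \<open>W0\<close> is \<open>W\<close> without the copy of \<open>A\<close>. The parameter value
  \<open>t = 1\<close> yields the points of \<open>B\<close>.\<close>

definition "W0 = join_map ` (Q \<times> {0<..1})"
definition "W = End1 ` A \<union> W0"
definition "S = End1 ` A \<union> join_map ` (T \<times> {0<..1})"

text \<open>The pair is deformed only where \<open>height < 1\<close>, so the second coordinate is unchanged at \<open>t = 1\<close>, and
  the whole deformation \<open>D\<close> is used where the final join parameter \<open>2 * height\<close> is below \<open>1\<close>.\<close>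

definition "height z t = max t (l z)"
definition "\<Gamma> = (\<lambda>(s, (z, t)). (D (z, s * min 1 (2 - 2 * height z t)), (1 - s) * t + s * min 1 (2 * height z t)))"

text \<open>The ends have their own clauses because an end point does not determine a pair: at
  parameter 0 the second coordinate is lost, at parameter 1 the first.\<close>

primrec push_point :: "real \<Rightarrow> 'a join \<Rightarrow> 'a join" where
  "push_point s (End1 x) = End1 x"
| "push_point s (End2 y) = End2 y"
| "push_point s (Inner x y t) = join_map (\<Gamma> (s, ((x, y), t)))"

definition "push = (\<lambda>(s, p). push_point s p)"

lemma T_subset_Q: "T \<subseteq> Q" by (auto simp: T_def Q_def B_def)

lemma E_subset: "E \<subseteq> topspace X1 \<times> topspace X2"
  using closedin_subset[OF closed_E] by simp

lemma Q_subset: "Q \<subseteq> topspace X1 \<times> topspace X2"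
  using E_subset by (auto simp: Q_def)

lemma D_in_Q: "z \<in> Q \<Longrightarrow> s \<in> {0..1} \<Longrightarrow> D (z, s) \<in> Q"
  using continuous_map_funspace[OF D] Q_subset by (auto simp: Pi_iff)

text \<open>At \<open>t = 1\<close> the height is 1, so \<open>D\<close> runs for time 0 and the
  parameter stays 1. This agrees with \<open>push\<close> fixing every \<open>End2\<close>
  point.\<close>

lemma push_join_map:
  assumes "z \<in> Q" "t \<in> {0<..1}" "s \<in> {0..1}"
  shows "push (s, join_map (z, t)) = join_map (\<Gamma> (s, (z, t)))"
proof (cases "t = 1")
  case True
  then have "height z t = 1" using l_range[OF assms(1)] by (auto simp: height_def)
  then show ?thesis using D_0[OF assms(1)] True by (simp add: push_def \<Gamma>_def join_map_def join_point_def)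
next
  case False
  then show ?thesis using assms by (simp add: push_def join_map_def join_point_def)
qed

text \<open>The new parameter is a convex combination of \<open>t\<close> and a number at least
  \<open>t\<close>. It therefore stays positive, and no point of \<open>W0\<close> is pushed onto an
  \<open>End1\<close> point.\<close>

lemma \<Gamma>_bounds:
  assumes "z \<in> Q" "t \<in> {0<..1}" "s \<in> {0..1}"
  shows "0 \<le> s * min 1 (2 - 2 * height z t)" "s * min 1 (2 - 2 * height z t) \<le> 1"
    and "0 < (1 - s) * t + s * min 1 (2 * height z t)" "(1 - s) * t + s * min 1 (2 * height z t) \<le> 1"
proof -
  have u: "height z t \<le> 1" "t \<le> height z t" using l_range[OF assms(1)] assms(2) by (auto simp: height_def)
  show "0 \<le> s * min 1 (2 - 2 * height z t)" "s * min 1 (2 - 2 * height z t) \<le> 1"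
    using u assms by (auto intro!: mult_le_one)
  have m: "min t 1 \<le> min 1 (2 * height z t)" "min 1 (2 * height z t) \<le> 1" "0 < t" "t \<le> 1" using u assms by auto
  have "t = (1 - s) * t + s * t" by (simp add: algebra_simps)
  also have "\<dots> \<le> (1 - s) * t + s * min 1 (2 * height z t)"
    using m assms by (intro add_mono mult_left_mono) auto
  finally show "0 < (1 - s) * t + s * min 1 (2 * height z t)" using m by simp
  show "(1 - s) * t + s * min 1 (2 * height z t) \<le> 1"
    using m assms by (intro convex_bound_le) auto
qed

text \<open>For the last claim: where \<open>height < 1/2\<close>, \<open>D\<close> runs to time 1
  and \<open>l < 1/2\<close>, so the pair ends in \<open>T\<close>; elsewhere the final parameter is
  1 and the point ends in \<open>B\<close>.\<close>

lemma push_maps: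
  assumes "s \<in> {0..1}"
  shows "p \<in> W \<Longrightarrow> push (s, p) \<in> W" and "p \<in> S \<Longrightarrow> push (s, p) \<in> S"
    and "p \<in> W \<Longrightarrow> push (0, p) = p" and "p \<in> W \<Longrightarrow> push (1, p) \<in> S"
proof -
  have *: "\<Gamma> (s, (z, t)) \<in> Q \<times> {0<..1}" "z \<in> T \<Longrightarrow> \<Gamma> (s, (z, t)) \<in> T \<times> {0<..1}"
    if "z \<in> Q" "t \<in> {0<..1}" "s \<in> {0..1}" for z t s
    using \<Gamma>_bounds[OF that] D_in_Q that D_T by (auto simp: \<Gamma>_def)
  show "push (s, p) \<in> W" if "p \<in> W"
    using that unfolding W_def
  proof
    assume "p \<in> W0"
    then obtain z t where p: "z \<in> Q" "t \<in> {0<..1}" "p = join_map (z, t)" unfolding W0_def by blast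
    then show "push (s, p) \<in> End1 ` A \<union> W0"
      unfolding p(3) push_join_map[OF p(1,2) assms] W0_def
      using *(1)[OF p(1,2) assms] by (intro UnI2 imageI)
  qed (auto simp: push_def)
  show "push (s, p) \<in> S" if "p \<in> S"
    using that unfolding S_def
  proof
    assume "p \<in> join_map ` (T \<times> {0<..1})"
    then obtain z t where p: "z \<in> T" "t \<in> {0<..1}" "p = join_map (z, t)" by blast
    then have "z \<in> Q" using T_subset_Q by blast
    then show "push (s, p) \<in> End1 ` A \<union> join_map ` (T \<times> {0<..1})"
      unfolding p(3) push_join_map[OF \<open>z \<in> Q\<close> p(2) assms]
      using *(2)[OF \<open>z \<in> Q\<close> p(2) assms p(1)] by (intro UnI2 imageI)
  qed (auto simp: push_def)
  show "push (0, p) = p" if "p \<in> W"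
    using that unfolding W_def
  proof
    assume "p \<in> W0"
    then obtain z t where p: "z \<in> Q" "t \<in> {0<..1}" "p = join_map (z, t)" unfolding W0_def by blast
    have "\<Gamma> (0, (z, t)) = (z, t)"
      using D_0[OF p(1)] by (simp add: \<Gamma>_def)
    then show "push (0, p) = p" using push_join_map[OF p(1,2), of 0] p(3) by simp
  qed (auto simp: push_def)
  show "push (1, p) \<in> S" if "p \<in> W"
    using that unfolding W_def
  proof
    assume "p \<in> End1 ` A" then show ?thesis by (auto simp: S_def push_def)
  next
    assume "p \<in> W0"
    then obtain z t where p: "z \<in> Q" "t \<in> {0<..1}" "p = join_map (z, t)" unfolding W0_def by blast
    have push: "push (1, p) = join_map (\<Gamma> (1, (z, t)))" using p push_join_map[of z t 1] by simp
    show ?thesis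
    proof (cases "height z t < 1 / 2")
      case True
      then have "\<Gamma> (1, (z, t)) = (D (z, 1), 2 * height z t)" "l z < 1 / 2" by (auto simp: \<Gamma>_def height_def)
      moreover have "\<Gamma> (1, (z, t)) \<in> T \<times> {0<..1}"
        using calculation D_1[of z] *(1)[OF p(1,2), of 1] p(1) by auto
      ultimately show ?thesis unfolding S_def push by (intro UnI2 imageI)
    next
      case False
      then have "snd (\<Gamma> (1, (z, t))) = 1" by (auto simp: \<Gamma>_def)
      moreover have "fst (\<Gamma> (1, (z, t))) \<in> Q" using *(1)[OF p(1,2), of 1] by auto
      moreover obtain x y where "fst (\<Gamma> (1, (z, t))) = (x, y)" by (metis surj_pair)
      ultimately have "(x, y) \<in> Q" "push (1, p) = End2 y"
        using push by (auto simp: join_map_def join_point_def)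
      \<comment> \<open>At parameter 1 the first coordinate is forgotten, so \<open>x\<close> may be
        exchanged for a point \<open>a\<close> of \<open>A\<close> below \<open>y\<close>.\<close>
      then obtain a where "(a, y) \<in> T" by (auto simp: Q_def B_def T_def)
      moreover have "push (1, p) = join_map ((a, y), 1)"
        using \<open>push (1, p) = End2 y\<close> by (simp add: join_map_def join_point_def)
      ultimately show ?thesis unfolding S_def by force
    qed
  qed
qed

section \<open>The topology of the preimage away from \<open>A\<close>\<close>

lemma W0_no_End1: "End1 x \<notin> W0"
  by (auto simp: W0_def join_map_def join_point_def split: if_splits)

lemma W0_subset: "W0 \<subseteq> topspace J"
  unfolding W0_def using Q_subset join_point_in_topspace_join[of _ X1 _ X2] by (auto simp: join_map_def)

text \<open>The second alternative arises because at \<open>t = 1\<close> any first coordinate gives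
  the same join point: the preimage of \<open>W0\<close> is larger than \<open>Q\<close> times
  \<open>{0<..1}\<close>.\<close>

lemma join_map_in_W0:
  assumes "z \<in> topspace X1 \<times> topspace X2" "t \<in> {0<..1}"
  shows "join_map (z, t) \<in> W0 \<longleftrightarrow> z \<in> Q \<or> t = 1 \<and> snd z \<in> B"
proof
  assume "join_map (z, t) \<in> W0"
  then obtain w r where "w \<in> Q" "r \<in> {0<..1}" "join_map (z, t) = join_map (w, r)"
    unfolding W0_def by auto
  then show "z \<in> Q \<or> t = 1 \<and> snd z \<in> B"
    using assms by (cases z; cases w) (auto simp: join_map_def join_point_def Q_def split: if_splits)
next
  assume "z \<in> Q \<or> t = 1 \<and> snd z \<in> B"
  then show "join_map (z, t) \<in> W0"
  proof
    assume "z \<in> Q" then show ?thesis using assms unfolding W0_def by blast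
  next
    assume *: "t = 1 \<and> snd z \<in> B"
    then obtain a where "(a, snd z) \<in> Q" by (auto simp: B_def Q_def)
    moreover have "join_map (z, t) = join_map ((a, snd z), 1)"
      using * by (simp add: join_map_def join_point_def)
    ultimately show ?thesis unfolding W0_def by auto
  qed
qed

text \<open>\<open>B\<close> is the projection of the compact set \<open>T\<close> to a Hausdorff
  space.\<close>

lemma closed_B: "closedin X2 B"
proof -
  have "compactin X2 (snd ` T)"
    using image_compactin[OF compact_T continuous_map_snd] .
  moreover have "snd ` T = B" by (force simp: T_def B_def)
  ultimately show ?thesis using compactin_imp_closedin[OF Hausdorff_X2] by simp
qed

lemma closed_Q: "closedin (prod_topology X1 X2) Q"
proof -
  have "closedin (prod_topology X1 X2) (topspace X1 \<times> B)"
    using closed_B by (simp add: closedin_prod_Times_iff)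
  then have "closedin (prod_topology X1 X2) (E \<inter> topspace X1 \<times> B)"
    using closed_E by (rule closedin_Int[rotated])
  moreover have "E \<inter> topspace X1 \<times> B = Q" using E_subset by (auto simp: Q_def)
  ultimately show ?thesis by simp
qed

text \<open>Restricting a quotient map to a set that is not saturated may destroy the quotient
  property. Here the full preimage of \<open>C\<close> adds to its part \<open>C1\<close> over
  \<open>Q\<close> only a slice at parameter 1, and this slice is closed because its projection to
  \<open>X2\<close> comes from the compact set \<open>T\<close>.\<close>

lemma quotient_map_W0:
  "quotient_map (prod_topology TQ (top_of_set {0<..1})) (subtopology J W0) join_map"
proof -
  let ?Y = "prod_topology TQ (top_of_set {0<..1::real})"
  let ?M = "prod_topology (prod_topology X1 X2) (top_of_set {0<..1::real})"
  have Y: "?Y = subtopology ?M (Q \<times> {0<..1})"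
    by (simp add: subtopology_Times subtopology_subtopology)
  have M: "?M = subtopology (prod_topology (prod_topology X1 X2) I) ((topspace X1 \<times> topspace X2) \<times> {0<..1})"
  proof -
    have "{0..1} \<inter> {0<..1} = {0<..1::real}" by auto
    then show ?thesis
      by (simp only: subtopology_Times subtopology_subtopology) (simp flip: topspace_prod_topology)
  qed
  have "openin I {0<..1}"
    by (auto simp: openin_open intro!: exI[of _ "{0<..}"])
  then have open_M: "openin (prod_topology (prod_topology X1 X2) I) ((topspace X1 \<times> topspace X2) \<times> {0<..1})"
    by (simp add: openin_prod_Times_iff)
  have topY: "topspace ?Y = Q \<times> {0<..1}" using Q_subset by auto
  have "continuous_map ?M J join_map"
    unfolding M using continuous_map_from_subtopology quotient_imp_continuous_map[OF quotient_map_join_map] by blast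
  then have contY: "continuous_map ?Y J join_map"
    unfolding Y by (rule continuous_map_from_subtopology)
  have im: "join_map ` topspace ?Y = topspace (subtopology J W0)"
    unfolding topY using W0_subset by (auto simp: W0_def)
  have cont: "continuous_map ?Y (subtopology J W0) join_map"
    using contY by (rule continuous_map_into_subtopology) (use topY in \<open>auto simp: W0_def\<close>)
  have closed: "closedin (subtopology J W0) C"
    if C: "C \<subseteq> W0" and cl: "closedin ?Y {p \<in> topspace ?Y. join_map p \<in> C}" for C
  proof -
    define C1 where "C1 = {p \<in> Q \<times> {0<..1}. join_map p \<in> C}"
    have C1: "closedin ?Y C1" using cl unfolding C1_def topY .
    have "closedin ?M (Q \<times> {0<..1})"
      using closed_Q by (simp add: closedin_prod_Times_iff)
    then have C1M: "closedin ?M C1" using C1 closedin_trans_full unfolding Y by blast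
    \<comment> \<open>The points of \<open>B\<close> in \<open>C\<close>. Each lies above a point of
      \<open>A\<close>, so \<open>C2\<close> is already the projection of a closed subset of the
      compact set \<open>T\<close>.\<close>
    define C2 where "C2 = {y \<in> B. End2 y \<in> C}"
    have "C2 = snd ` ({z \<in> topspace TQ. (z, 1) \<in> C1} \<inter> T)"
    proof -
      have 1: "y \<in> C2 \<longleftrightarrow> (\<exists>z\<in>T. snd z = y \<and> (z, 1) \<in> C1)" for y
      proof
        assume "y \<in> C2"
        then obtain a where "(a, y) \<in> T" "End2 y \<in> C" by (auto simp: C2_def B_def T_def)
        then show "\<exists>z\<in>T. snd z = y \<and> (z, 1) \<in> C1"
          using T_subset_Q by (intro bexI[of _ "(a, y)"]) (auto simp: C1_def join_map_def join_point_def)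
      next
        assume "\<exists>z\<in>T. snd z = y \<and> (z, 1) \<in> C1"
        then show "y \<in> C2" by (auto simp: C2_def C1_def B_def T_def join_map_def join_point_def)
      qed
      have 2: "{z \<in> topspace TQ. (z, 1) \<in> C1} \<inter> T = {z \<in> T. (z, 1) \<in> C1}"
        using Q_subset T_subset_Q by auto
      show ?thesis unfolding 2 image_def by (rule set_eqI) (unfold 1 mem_Collect_eq, blast)
    qed
    moreover have "compactin X2 (snd ` ({z \<in> topspace TQ. (z, 1) \<in> C1} \<inter> T))"
    proof (rule image_compactin)
      show "continuous_map TQ X2 snd" by (rule continuous_map_subtopology_snd)
      have "continuous_map TQ ?Y (\<lambda>z. (z, 1))" by (simp add: continuous_map_pairwise o_def)
      then have "closedin TQ {z \<in> topspace TQ. (z, 1) \<in> C1}"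
        using C1 closedin_continuous_map_preimage by blast
      moreover have "compactin TQ T" using compact_T T_subset_Q by (simp add: compactin_subtopology)
      ultimately show "compactin TQ ({z \<in> topspace TQ. (z, 1) \<in> C1} \<inter> T)"
        by (rule closed_Int_compactin)
    qed
    ultimately have "closedin X2 C2" using compactin_imp_closedin[OF Hausdorff_X2] by simp
    then have "closedin ?M ((topspace X1 \<times> C2) \<times> {1})"
      by (simp add: closedin_prod_Times_iff closedin_subtopology_refl)
    then have K: "closedin ?M (C1 \<union> (topspace X1 \<times> C2) \<times> {1})" using C1M by auto
    \<comment> \<open>The complement of \<open>C\<close> off the \<open>End1\<close> points. It is
      open in the whole join, and its complement cuts \<open>C\<close> out of
      \<open>W0\<close>.\<close>
    define V where "V = {p \<in> topspace J. p \<notin> range End1 \<and> p \<notin> C}"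
    have C1C2: "join_map (z, t) \<in> C \<longleftrightarrow> (z, t) \<in> C1 \<union> (topspace X1 \<times> C2) \<times> {1}"
      if "z \<in> topspace X1 \<times> topspace X2" "t \<in> {0<..1}" for z t
    proof
      assume *: "join_map (z, t) \<in> C"
      then have "z \<in> Q \<or> t = 1 \<and> snd z \<in> B" using C join_map_in_W0[OF that] by blast
      then show "(z, t) \<in> C1 \<union> (topspace X1 \<times> C2) \<times> {1}"
        using * that by (cases z) (auto simp: C1_def C2_def join_map_def join_point_def)
    next
      assume "(z, t) \<in> C1 \<union> (topspace X1 \<times> C2) \<times> {1}"
      then show "join_map (z, t) \<in> C" by (auto simp: C1_def C2_def join_map_def join_point_def)
    qed
    have "{p \<in> (topspace X1 \<times> topspace X2) \<times> {0..1}. join_map p \<in> V}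
        = topspace ?M - (C1 \<union> (topspace X1 \<times> C2) \<times> {1})"
    proof -
      have "join_map (z, t) \<in> V \<longleftrightarrow> 0 < t \<and> (z, t) \<notin> C1 \<union> (topspace X1 \<times> C2) \<times> {1}"
        if "z \<in> topspace X1 \<times> topspace X2" "t \<in> {0..1}" for z t
      proof (cases "t = 0")
        case True
        then show ?thesis by (auto simp: V_def join_map_def join_point_def)
      next
        case False
        then have "join_map (z, t) \<in> topspace J"  "join_map (z, t) \<notin> range End1"
          using that join_point_in_topspace_join[of "fst z" X1 "snd z" X2 t] by (auto simp: join_map_def) (auto simp: join_point_def split: if_splits)
        then show ?thesis using C1C2[of z t] that False by (auto simp: V_def)
      qed
      then have "w \<in> (topspace X1 \<times> topspace X2) \<times> {0..1} \<and> join_map w \<in> V \<longleftrightarrow>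
          w \<in> (topspace X1 \<times> topspace X2) \<times> {0<..1} - (C1 \<union> (topspace X1 \<times> C2) \<times> {1})" for w
        by (cases w) (simp only: mem_Times_iff fst_conv snd_conv Diff_iff; auto)
      then show ?thesis by (simp only: topspace_prod_topology topspace_euclidean_subtopology) blast
    qed
    moreover have "openin ?M (topspace ?M - (C1 \<union> (topspace X1 \<times> C2) \<times> {1}))"
      using K by blast
    then have "openin (prod_topology (prod_topology X1 X2) I) (topspace ?M - (C1 \<union> (topspace X1 \<times> C2) \<times> {1}))"
      by (simp only: openin_trans_full[OF _ open_M] M)
    ultimately have "openin J V" unfolding openin_join_topology by (auto simp: V_def)
    moreover have "C = W0 \<inter> (topspace J - V)"
      using C W0_subset W0_no_End1 by (auto simp: V_def)
    ultimately show ?thesis by (auto simp: closedin_subtopology)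
  qed
  show ?thesis
    unfolding quotient_map_closedin
    using im closed closedin_continuous_map_preimage[OF cont] by auto
qed

section \<open>Continuity of the push\<close>

lemma continuous_map_\<Gamma>:
  "continuous_map (prod_topology I (prod_topology TQ (top_of_set {0<..1}))) (prod_topology (prod_topology X1 X2) I) \<Gamma>"
proof -
  let ?Z = "prod_topology I (prod_topology TQ (top_of_set {0<..1::real}))"
  note c = continuous_map_compose[unfolded o_def]
  have topZ: "topspace ?Z = {0..1} \<times> Q \<times> {0<..1}" using Q_subset by auto
  have s: "continuous_map ?Z euclideanreal (\<lambda>p. fst p)"
    using continuous_map_fst continuous_map_into_fulltopology by blast
  have z: "continuous_map ?Z TQ (\<lambda>p. fst (snd p))"
    by (rule c[OF continuous_map_snd continuous_map_fst])
  have t: "continuous_map ?Z euclideanreal (\<lambda>p. snd (snd p))"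
    using c[OF continuous_map_snd continuous_map_snd] continuous_map_into_fulltopology by blast
  have u: "continuous_map ?Z euclideanreal (\<lambda>p. height (fst (snd p)) (snd (snd p)))"
    unfolding height_def by (intro continuous_map_real_max t c[OF z l])
  have dom: "fst (snd p) \<in> Q" "snd (snd p) \<in> {0<..1}" "fst p \<in> {0..1}" if "p \<in> topspace ?Z" for p
    using that unfolding topZ by auto
  have "continuous_map ?Z I (\<lambda>p. fst p * min 1 (2 - 2 * height (fst (snd p)) (snd (snd p))))"
  proof (rule continuous_map_into_subtopology)
    show "(\<lambda>p. fst p * min 1 (2 - 2 * height (fst (snd p)) (snd (snd p)))) \<in> topspace ?Z \<rightarrow> {0..1}"
    proof
      fix p assume "p \<in> topspace ?Z"
      from \<Gamma>_bounds(1,2)[OF dom[OF this]]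
      show "fst p * min 1 (2 - 2 * height (fst (snd p)) (snd (snd p))) \<in> {0..1}" by simp
    qed
  qed (intro continuous_map_real_mult continuous_map_real_min continuous_map_diff continuous_map_const[THEN iffD2] s u, simp_all)
  then have "continuous_map ?Z (prod_topology TQ I) (\<lambda>p. (fst (snd p), fst p * min 1 (2 - 2 * height (fst (snd p)) (snd (snd p)))))"
    using z by (simp add: continuous_map_pairwise o_def)
  from c[OF this D]
  have 1: "continuous_map ?Z (prod_topology X1 X2) (\<lambda>p. D (fst (snd p), fst p * min 1 (2 - 2 * height (fst (snd p)) (snd (snd p)))))"
    by (rule continuous_map_into_fulltopology)
  have 2: "continuous_map ?Z I (\<lambda>p. (1 - fst p) * snd (snd p) + fst p * min 1 (2 * height (fst (snd p)) (snd (snd p))))"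
  proof (rule continuous_map_into_subtopology)
    show "(\<lambda>p. (1 - fst p) * snd (snd p) + fst p * min 1 (2 * height (fst (snd p)) (snd (snd p)))) \<in> topspace ?Z \<rightarrow> {0..1}"
    proof
      fix p assume "p \<in> topspace ?Z"
      from \<Gamma>_bounds(3,4)[OF dom[OF this]]
      show "(1 - fst p) * snd (snd p) + fst p * min 1 (2 * height (fst (snd p)) (snd (snd p))) \<in> {0..1}" by simp
    qed
  qed (intro continuous_map_add continuous_map_real_mult continuous_map_real_min continuous_map_diff continuous_map_const[THEN iffD2] s t u, simp_all)
  show ?thesis
    using 1 2 by (simp add: continuous_map_pairwise o_def \<Gamma>_def case_prod_unfold)
qed

text \<open>The time interval is compact Hausdorff, so its product with the quotient map onto
  \<open>W0\<close> is again a quotient map; continuity of \<open>push\<close> is then read off from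
  \<open>\<Gamma>\<close>.\<close>

lemma continuous_map_push_W0: "continuous_map (prod_topology I (subtopology J W0)) J push"
proof -
  have "quotient_map (prod_topology I (prod_topology TQ (top_of_set {0<..1})))
      (prod_topology I (subtopology J W0)) (\<lambda>(x, y). (x, join_map y))"
    by (intro quotient_map_prod_right quotient_map_W0)
      (simp_all add: compact_imp_locally_compact_space compact_space_subtopology Hausdorff_space_subtopology)
  then show ?thesis
  proof (rule continuous_compose_quotient_map)
    have "continuous_map (prod_topology I (prod_topology TQ (top_of_set {0<..1}))) J (join_map \<circ> \<Gamma>)"
      using continuous_map_\<Gamma> quotient_imp_continuous_map[OF quotient_map_join_map] by (rule continuous_map_compose)
    then show "continuous_map (prod_topology I (prod_topology TQ (top_of_set {0<..1}))) J (push \<circ> (\<lambda>(x, y). (x, join_map y)))"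
      by (rule continuous_map_eq) (use push_join_map in auto)
  qed
qed


text \<open>\<open>W0\<close> is open in \<open>W\<close>, which settles its points. At
  \<open>End1 a\<close> a neighbourhood is built by hand: compactness of the fibre over
  \<open>a\<close> gives uniform control along it, and upper semicontinuity carries this to nearby
  fibres.\<close>

lemma continuous_map_push: "continuous_map (prod_topology I (subtopology J W)) J push"
proof -
  let ?Z = "prod_topology I (subtopology J W)"
  have "topcontinuous_at ?Z J push w" if w: "w \<in> topspace ?Z" for w
  proof -
    obtain s p where sp: "w = (s, p)" "s \<in> {0..1}" "p \<in> W" "p \<in> topspace J"
      using w by auto
    have "push ` topspace ?Z \<subseteq> topspace J"
      using continuous_map_image_subset_topspace[OF continuous_map_push_W0] by (fastforce simp: W_def push_def)
    moreover have "\<exists>N. openin ?Z N \<and> w \<in> N \<and> (\<forall>y\<in>N. push y \<in> V)" if V: "openin J V" "push w \<in> V" for V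
    proof (cases "p \<in> W0")
      case True
      have "openin (subtopology J W) W0"
      proof -
        have "{q \<in> (topspace X1 \<times> topspace X2) \<times> {0..1}. join_map q \<in> topspace J - range End1}
            = (topspace X1 \<times> topspace X2) \<times> {0<..1}"
          using join_point_in_topspace_join[of _ X1 _ X2]
          by (auto simp: join_map_def) (auto simp: join_point_def split: if_splits)
        moreover have "openin I {0<..1}"
          by (auto simp: openin_open intro!: exI[of _ "{0<..}"])
        ultimately have "openin J (topspace J - range End1)"
          unfolding openin_join_topology by (auto simp: openin_prod_Times_iff)
        moreover have "W0 = (topspace J - range End1) \<inter> W"
          using W0_subset W0_no_End1 by (auto simp: W_def)
        ultimately show ?thesis by (auto simp: openin_subtopology)
      qed
      then have "openin ?Z ({0..1} \<times> W0)"
        by (auto simp: openin_prod_Times_iff)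
      moreover have "openin (subtopology ?Z ({0..1} \<times> W0)) {y \<in> topspace (prod_topology I (subtopology J W0)). push y \<in> V}"
      proof -
        have "prod_topology I (subtopology J W0) = subtopology ?Z ({0..1} \<times> W0)"
          by (simp add: subtopology_Times subtopology_subtopology W_def Int_absorb1)
        then show ?thesis using openin_continuous_map_preimage[OF continuous_map_push_W0 V(1)] by simp
      qed
      ultimately have "openin ?Z {y \<in> topspace (prod_topology I (subtopology J W0)). push y \<in> V}"
        by (rule openin_trans_full[rotated])
      then show ?thesis using sp V True by (intro exI conjI) auto
    next
      case False
      then obtain a where a: "a \<in> A" "p = End1 a" using sp by (auto simp: W_def)
      then have a1: "a \<in> topspace X1" using A_subset by blast
      have fib: "{a} \<times> E `` {a} \<subseteq> T" "{a} \<times> E `` {a} \<subseteq> Q"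
        using a T_subset_Q by (auto simp: T_def Q_def B_def)
      have cfib: "compactin (prod_topology X1 X2) ({a} \<times> E `` {a})"
        using a1 fibre_compact by (simp add: compactin_Times)
      let ?M = "prod_topology (prod_topology X1 X2) I"
      have "openin ?M {q \<in> topspace ?M. join_map q \<in> V}"
        using V(1) quotient_imp_continuous_map[OF quotient_map_join_map] openin_continuous_map_preimage by blast
      \<comment> \<open>At parameter 0 every pair over \<open>a\<close> gives \<open>End1 a\<close>,
        so the whole compact fibre at parameter 0 lies in the preimage of \<open>V\<close> and has a
        product neighbourhood inside it.\<close>
      from tube_lemma_left[OF this cfib, of 0]
      have "({a} \<times> E `` {a}) \<times> {0} \<subseteq> {q \<in> topspace ?M. join_map q \<in> V} \<Longrightarrow>
        \<exists>U0 I0. openin (prod_topology X1 X2) U0 \<and> openin I I0 \<and> {a} \<times> E `` {a} \<subseteq> U0 \<and> 0 \<in> I0 \<and>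
          U0 \<times> I0 \<subseteq> {q \<in> topspace ?M. join_map q \<in> V}" by simp
      moreover have "({a} \<times> E `` {a}) \<times> {0} \<subseteq> {q \<in> topspace ?M. join_map q \<in> V}"
        using V(2) a sp fib Q_subset by (auto simp: push_def join_map_def join_point_def)
      ultimately obtain U0 I0 where U0: "openin (prod_topology X1 X2) U0" "{a} \<times> E `` {a} \<subseteq> U0"
        and I0: "openin I I0" "0 \<in> I0" and UI: "U0 \<times> I0 \<subseteq> {q \<in> topspace ?M. join_map q \<in> V}"
        by blast
      obtain \<epsilon> where \<epsilon>: "0 < \<epsilon>" "\<epsilon> \<le> 1" "{0..<\<epsilon>} \<subseteq> I0"
      proof -
        obtain e where "e > 0" "ball 0 e \<inter> {0..1} \<subseteq> I0"
          using I0 by (auto simp: openin_contains_ball)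
        then show ?thesis by (intro that[of "min e 1"]) (auto simp: subset_iff)
      qed
      \<comment> \<open>\<open>D\<close> fixes the fibre at all times; by compactness of fibre and
        time interval some neighbourhood \<open>U1\<close> of the fibre stays in \<open>U0\<close>
        throughout the deformation.\<close>
      have o1: "openin (prod_topology TQ I) {q \<in> topspace (prod_topology TQ I). D q \<in> U0 \<inter> Q}"
        by (rule openin_continuous_map_preimage[OF D]) (use U0 in \<open>auto simp: openin_subtopology\<close>)
      have o2: "({a} \<times> E `` {a}) \<times> {0..1} \<subseteq> {q \<in> topspace (prod_topology TQ I). D q \<in> U0 \<inter> Q}"
      proof
        fix q assume "q \<in> ({a} \<times> E `` {a}) \<times> {0..1::real}"
        then obtain z r where q: "q = (z, r)" "z \<in> {a} \<times> E `` {a}" "r \<in> {0..1}" by blast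
        then have "z \<in> T" "z \<in> Q" "z \<in> U0" using fib U0 by auto
        then show "q \<in> {q \<in> topspace (prod_topology TQ I). D q \<in> U0 \<inter> Q}"
          using q D_T[of z r] Q_subset by auto
      qed
      have o3: "compactin TQ ({a} \<times> E `` {a})"
        using cfib fib by (simp add: compactin_subtopology)
      have o4: "compactin I {0..1}" by (simp add: compactin_subtopology)
      obtain U1 I1 where U1: "openin TQ U1" "{a} \<times> E `` {a} \<subseteq> U1"
        and I1: "{0..1} \<subseteq> I1" "U1 \<times> I1 \<subseteq> {q \<in> topspace (prod_topology TQ I). D q \<in> U0 \<inter> Q}"
        by (rule Wallace_theorem_prod_topology[OF o3 o4 o1 o2])
      \<comment> \<open>The bound \<open>\<epsilon> / 2\<close> on both \<open>l\<close> and
        \<open>t\<close> gives \<open>2 * height z t < \<epsilon>\<close>, which keeps the pushed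
        parameter in \<open>I0\<close>.\<close>
      define U2 where "U2 = U1 \<inter> {z \<in> topspace TQ. l z \<in> {..<\<epsilon> / 2}}"
      have "openin TQ U2"
        unfolding U2_def using U1 by (intro openin_Int openin_continuous_map_preimage[OF l]) auto
      then obtain U3 where U3: "openin (prod_topology X1 X2) U3" "U2 = U3 \<inter> Q"
        by (auto simp: openin_subtopology)
      have "{a} \<times> E `` {a} \<subseteq> U3"
        using U1 fib l_T \<epsilon> Q_subset U3 by (fastforce simp: U2_def)
      then obtain Ua V2 where Ua: "openin X1 Ua" "a \<in> Ua" and V2: "openin X2 V2" "E `` {a} \<subseteq> V2" and UV: "Ua \<times> V2 \<subseteq> U3"
        using Wallace_theorem_prod_topology[OF _ fibre_compact[OF a1] U3(1), of "{a}"] a1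
        by (metis compactin_sing insert_subset)
      \<comment> \<open>Upper semicontinuity enters here: fibres over \<open>U\<close> lie in
        \<open>V2\<close>, so every pair of \<open>Q\<close> over \<open>U\<close> belongs to
        \<open>U2\<close>.\<close>
      define U where "U = Ua \<inter> {x \<in> topspace X1. E `` {x} \<subseteq> V2}"
      have U: "openin X1 U" "a \<in> U"
        unfolding U_def using Ua V2 fibre_usc a1 by auto
      have E_U: "z \<in> U2" if "z \<in> Q" "fst z \<in> U" for z
      proof -
        have "z \<in> E" using that by (simp add: Q_def)
        then have "z \<in> Ua \<times> V2" using that by (cases z) (auto simp: U_def)
        then show ?thesis using UV U3 that by auto
      qed
      have U2: "D (z, r) \<in> U0" "l z < \<epsilon> / 2" if "z \<in> U2" "r \<in> {0..1}" for z r
      proof -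
        have "(z, r) \<in> U1 \<times> I1" using that I1 by (auto simp: U2_def)
        then show "D (z, r) \<in> U0" using I1 by blast
        show "l z < \<epsilon> / 2" using that by (auto simp: U2_def)
      qed
      define N where "N = {p \<in> topspace J. \<exists>x y t. p = join_point x y t \<and> x \<in> U \<and> y \<in> topspace X2 \<and> 0 \<le> t \<and> t < \<epsilon> / 2}"
      have "openin J N"
      proof -
        have "{p \<in> (topspace X1 \<times> topspace X2) \<times> {0..1}. join_map p \<in> N} = (U \<times> topspace X2) \<times> {0..<\<epsilon> / 2}"
        proof -
          have "join_point x y t \<in> N \<longleftrightarrow> x \<in> U \<and> t < \<epsilon> / 2"
            if "x \<in> topspace X1" "y \<in> topspace X2" "0 \<le> t" "t \<le> 1" for x y t
          proof
            assume "join_point x y t \<in> N"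
            then obtain x' y' t' where "join_point x y t = join_point x' y' t'" "x' \<in> U" "0 \<le> t'" "t' < \<epsilon> / 2"
              by (auto simp: N_def)
            then show "x \<in> U \<and> t < \<epsilon> / 2"
              using \<epsilon> that by (auto simp: join_point_def split: if_splits)
          next
            assume "x \<in> U \<and> t < \<epsilon> / 2"
            then show "join_point x y t \<in> N"
              using that join_point_in_topspace_join[OF that] unfolding N_def by blast
          qed
          moreover have "U \<subseteq> topspace X1" by (auto simp: U_def)
          ultimately show ?thesis using \<epsilon> by (auto simp: join_map_def)
        qed
        moreover have "openin I {0..<\<epsilon> / 2}"
          unfolding openin_open using \<epsilon> by (intro exI[of _ "{..<\<epsilon> / 2}"]) auto
        ultimately show ?thesis
          unfolding openin_join_topology using U by (auto simp: openin_prod_Times_iff N_def)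
      qed
      then have "openin ?Z ({0..1} \<times> (W \<inter> N))"
        by (auto simp: openin_prod_Times_iff openin_subtopology)
      moreover have "w \<in> {0..1} \<times> (W \<inter> N)"
      proof -
        obtain y where "y \<in> E `` {a}" using fibre_nonempty[OF a1] by blast
        then have "y \<in> topspace X2" using E_subset by blast
        moreover have "p = join_point a y 0" using a by (simp add: join_point_def)
        ultimately have "p \<in> N" unfolding N_def using sp U \<epsilon> by force
        then show ?thesis using sp by simp
      qed
      moreover have "push v \<in> V" if v_in: "v \<in> {0..1} \<times> (W \<inter> N)" for v
      proof -
        obtain r p' where v: "v = (r, p')" "r \<in> {0..1}" "p' \<in> W" "p' \<in> N" using v_in by blast
        obtain x y t where p': "p' = join_point x y t" "x \<in> U" "y \<in> topspace X2" "0 \<le> t" "t < \<epsilon> / 2"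
          using v by (auto simp: N_def)
        have join_map_V: "join_map (z, t) \<in> V" if "z \<in> U0" "0 \<le> t" "t < \<epsilon>" for z t
        proof -
          have "(z, t) \<in> U0 \<times> I0" using that \<epsilon> by auto
          then show ?thesis using UI by blast
        qed
        show ?thesis
        proof (cases "t = 0")
          case True
          then have "p' = End1 x" using p' by (simp add: join_point_def)
          then have "x \<in> A" using v W0_no_End1 by (auto simp: W_def)
          \<comment> \<open>\<open>push\<close> fixes \<open>End1 x\<close>. A pair over
            \<open>x\<close> exhibits this point as the parameter 0 point over an element of
            \<open>U0\<close>.\<close>
          obtain y' where y': "(x, y') \<in> E" using fibre_nonempty[of x] A_subset \<open>x \<in> A\<close> by auto
          then have xy: "(x, y') \<in> T" "(x, y') \<in> Q" using \<open>x \<in> A\<close> T_subset_Q by (auto simp: T_def)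
          then have "(x, y') \<in> U0" using U2(1)[OF E_U, of "(x, y')" 0] D_T[of "(x, y')" 0] p' by simp
          from join_map_V[OF this, of 0] \<epsilon> show ?thesis
            by (simp add: v \<open>p' = End1 x\<close> push_def join_map_def join_point_def)
        next
          case False
          then have t: "t \<in> {0<..1}" using p' \<epsilon> by auto
          have eq: "p' = join_map ((x, y), t)" using p' by (simp add: join_map_def)
          have "(x, y) \<in> Q"
          proof -
            have "p' \<in> W0" using v False p' \<epsilon> by (auto simp: W_def join_point_def split: if_splits)
            moreover have "(x, y) \<in> topspace X1 \<times> topspace X2" using p' by (auto simp: U_def)
            \<comment> \<open>The alternative \<open>t = 1\<close> is excluded by
              \<open>t < \<epsilon> / 2 \<le> 1 / 2\<close>.\<close>
            ultimately show ?thesis using join_map_in_W0[of "(x, y)" t] t eq p' \<epsilon> by auto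
          qed
          define z where "z = (x, y)"
          have z: "z \<in> Q" "z \<in> U2" "p' = join_map (z, t)" using \<open>(x, y) \<in> Q\<close> E_U[of z] p' eq by (auto simp: z_def)
          have "push v = join_map (\<Gamma> (r, (z, t)))" unfolding v(1) z(3) by (rule push_join_map[OF z(1) t v(2)])
          moreover have "fst (\<Gamma> (r, (z, t))) \<in> U0"
            using U2(1)[OF z(2)] \<Gamma>_bounds[OF z(1) t v(2)] by (simp add: \<Gamma>_def)
          moreover have "0 \<le> snd (\<Gamma> (r, (z, t)))" "snd (\<Gamma> (r, (z, t))) < \<epsilon>"
          proof -
            show "0 \<le> snd (\<Gamma> (r, (z, t)))" using \<Gamma>_bounds[OF z(1) t v(2)] by (simp add: \<Gamma>_def)
            have "2 * height z t < \<epsilon>" using U2(2)[OF z(2), of 0] p' by (simp add: height_def)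
            then have "(1 - r) * t + r * min 1 (2 * height z t) < \<epsilon>"
              using p' v(2) \<epsilon> by (intro convex_bound_lt) auto
            then show "snd (\<Gamma> (r, (z, t))) < \<epsilon>" by (simp add: \<Gamma>_def)
          qed
          ultimately show ?thesis using join_map_V by (metis prod.collapse)
        qed
      qed
      ultimately show ?thesis by blast
    qed
    ultimately show ?thesis
      using w unfolding topcontinuous_at_def by blast
  qed
  then show ?thesis by (simp add: continuous_map_eq_topcontinuous_at)
qed

lemma S_subset_W: "S \<subseteq> W"
  using T_subset_Q by (auto simp: S_def W_def W0_def)

lemma homotopy_equivalence_map_S_W:
  "homotopy_equivalence_map (subtopology J S) (subtopology J W) id"
proof (rule homotopy_equivalence_map_weak_deformation)
  show "S \<subseteq> W" by (rule S_subset_W)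
  show "continuous_map (prod_topology I (subtopology J W)) (subtopology J W) push"
    using continuous_map_push by (rule continuous_map_into_subtopology) (use push_maps(1) in auto)
qed (use push_maps(2) push_maps(3,4)[of 0] in auto)

end

subsection \<open>Finite unions of compact convex sets\<close>

text \<open>A flexible stand-in for compact polyhedra: it also admits cutting by balls, is stable
  under intersections, products and linear images, and yields compact ENRs.\<close>

definition finite_convex_union :: "'e::euclidean_space set \<Rightarrow> bool" where
  "finite_convex_union S \<longleftrightarrow> (\<exists>\<C>. finite \<C> \<and> (\<forall>C\<in>\<C>. compact C \<and> convex C) \<and> S = \<Union>\<C>)"

lemma finite_convex_unionI:
  "finite \<C> \<Longrightarrow> (\<And>C. C \<in> \<C> \<Longrightarrow> compact C \<and> convex C) \<Longrightarrow> finite_convex_union (\<Union>\<C>)"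
  by (auto simp: finite_convex_union_def)

lemma finite_convex_union_ENR: "finite_convex_union S \<Longrightarrow> ENR S"
  by (auto simp: finite_convex_union_def intro!: ENR_finite_Union_convex_closed compact_imp_closed)

lemma finite_convex_union_compact: "finite_convex_union S \<Longrightarrow> compact S"
  by (auto simp: finite_convex_union_def intro!: compact_Union)

lemma finite_convex_union_cball: "finite_convex_union (cball a r)"
  using finite_convex_unionI[of "{cball a r}"] by simp

lemma finite_convex_union_Int:
  assumes "finite_convex_union S" "finite_convex_union T"
  shows "finite_convex_union (S \<inter> T)"
proof -
  obtain \<C> \<D> where "finite \<C>" "\<forall>C\<in>\<C>. compact C \<and> convex C" "S = \<Union>\<C>"
    and "finite \<D>" "\<forall>C\<in>\<D>. compact C \<and> convex C" "T = \<Union>\<D>"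
    using assms by (auto simp: finite_convex_union_def)
  moreover from this have "S \<inter> T = \<Union>((\<lambda>(C, D). C \<inter> D) ` (\<C> \<times> \<D>))" by auto
  ultimately show ?thesis
    by (auto intro!: finite_convex_unionI convex_Int compact_Int)
qed

lemma finite_convex_union_Times:
  assumes "finite_convex_union S" "finite_convex_union T"
  shows "finite_convex_union (S \<times> T)"
proof -
  obtain \<C> \<D> where "finite \<C>" "\<forall>C\<in>\<C>. compact C \<and> convex C" "S = \<Union>\<C>"
    and "finite \<D>" "\<forall>C\<in>\<D>. compact C \<and> convex C" "T = \<Union>\<D>"
    using assms by (auto simp: finite_convex_union_def)
  moreover from this have "S \<times> T = \<Union>((\<lambda>(C, D). C \<times> D) ` (\<C> \<times> \<D>))" by auto
  ultimately show ?thesis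
    by (auto intro!: finite_convex_unionI convex_Times compact_Times)
qed

lemma finite_convex_union_linear_image:
  fixes f :: "'e::euclidean_space \<Rightarrow> 'f::euclidean_space"
  assumes "finite_convex_union S" "linear f"
  shows "finite_convex_union (f ` S)"
proof -
  obtain \<C> where "finite \<C>" "\<forall>C\<in>\<C>. compact C \<and> convex C" "S = \<Union>\<C>"
    using assms by (auto simp: finite_convex_union_def)
  moreover from this have "f ` S = \<Union>((`) f ` \<C>)" by auto
  ultimately show ?thesis
    using assms(2)
    by (auto intro!: finite_convex_unionI convex_linear_image compact_continuous_image
        linear_continuous_on simp: linear_conv_bounded_linear)
qed

lemma rectilinear_complex_cell:
  "rectilinear_complex K \<Longrightarrow> S \<in> K \<Longrightarrow> compact S" "rectilinear_complex K \<Longrightarrow> S \<in> K \<Longrightarrow> convex S"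
  by (auto simp: rectilinear_complex_def dest!: bspec intro: compact_simplex convex_simplex)

text \<open>The carrier is closed, so its part in \<open>C\<close> is compact and finitely many of
  the locally finite neighbourhoods cover it; a simplex meeting \<open>C\<close> meets one of
  these.\<close>

lemma rectilinear_complex_locally_finite:
  assumes K: "rectilinear_complex K" and C: "compact C"
  shows "finite {S \<in> K. S \<inter> C \<noteq> {}}"
proof -
  have "\<forall>x\<in>\<Union>K. \<exists>V. open V \<and> x \<in> V \<and> finite {S \<in> K. S \<inter> V \<noteq> {}}"
    using K by (simp add: rectilinear_complex_def)
  then obtain V where V: "\<And>x. x \<in> \<Union>K \<Longrightarrow> open (V x) \<and> x \<in> V x \<and> finite {S \<in> K. S \<inter> V x \<noteq> {}}"
    by metis
  have "compact (C \<inter> \<Union>K)"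
    using K C by (auto simp: rectilinear_complex_def intro: compact_Int_closed)
  moreover have "C \<inter> \<Union>K \<subseteq> \<Union>(V ` (C \<inter> \<Union>K))" "\<And>B. B \<in> V ` (C \<inter> \<Union>K) \<Longrightarrow> open B" using V by blast+
  ultimately obtain F where F: "F \<subseteq> V ` (C \<inter> \<Union>K)" "finite F" "C \<inter> \<Union>K \<subseteq> \<Union>F"
    by (meson compactE)
  have "finite (\<Union>U\<in>F. {S \<in> K. S \<inter> U \<noteq> {}})"
    using F V by blast
  moreover have "{S \<in> K. S \<inter> C \<noteq> {}} \<subseteq> (\<Union>U\<in>F. {S \<in> K. S \<inter> U \<noteq> {}})"
    using F(3) by blast
  ultimately show ?thesis by (rule rev_finite_subset)
qed

lemma finite_convex_union_polyhedron:
  assumes "rectilinear_complex K" "compact (\<Union>K)"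
  shows "finite_convex_union (\<Union>K)"
proof -
  have "finite ({S \<in> K. S \<inter> \<Union>K \<noteq> {}})"
    using assms by (rule rectilinear_complex_locally_finite)
  then have "finite_convex_union (\<Union>{S \<in> K. S \<inter> \<Union>K \<noteq> {}})"
    using assms rectilinear_complex_cell by (intro finite_convex_unionI) auto
  moreover have "\<Union>{S \<in> K. S \<inter> \<Union>K \<noteq> {}} = \<Union>K" by auto
  ultimately show ?thesis by simp
qed

subsection \<open>Geometric posets\<close>

text \<open>A polygonal path is at least as long as its chord. This turns smallness in the Hausdorff
  metric of (A2) into Euclidean smallness.\<close>

lemma dist_le_length_dist: "ennreal (dist x y) \<le> length_dist D x y"
proof -
  have path: "ennreal (dist (hd p) (last p)) \<le> (\<Sum>i<length p - 1. ennreal (dist (p ! i) (p ! Suc i)))"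
    if "p \<noteq> []" for p :: "'a list"
    using that
  proof (induction p rule: list_nonempty_induct)
    case (cons a p)
    have "ennreal (dist a (last p)) \<le> ennreal (dist a (hd p)) + ennreal (dist (hd p) (last p))"
      by (simp add: dist_triangle flip: ennreal_plus)
    also have "\<dots> \<le> ennreal (dist a (hd p)) + (\<Sum>i<length p - 1. ennreal (dist (p ! i) (p ! Suc i)))"
      by (intro add_left_mono cons.IH)
    also have "\<dots> = (\<Sum>i<Suc (length p - 1). ennreal (dist ((a # p) ! i) ((a # p) ! Suc i)))"
      using cons.hyps by (subst sum.lessThan_Suc_shift) (simp add: hd_conv_nth)
    finally show ?case using cons.hyps by simp
  qed simp
  show ?thesis
    unfolding length_dist_def using path by (auto intro!: Inf_greatest)
qed

context geometric_M_poset
begin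

lemma topspace_stratum_space [simp]: "topspace (stratum_space X \<mu> r) = stratum X \<mu> r"
  by (auto simp: stratum_def)

lemma stratum_subset: "stratum X \<mu> r \<subseteq> topspace X"
  by (auto simp: stratum_def)

lemma homeomorphic_map_\<phi>: "homeomorphic_map X (top_of_set (\<phi> ` topspace X)) \<phi>"
  using embedding by (simp add: embedding_map_def)

lemma inj_\<phi>: "inj_on \<phi> (topspace X)"
  using homeomorphic_map_\<phi> by (simp add: homeomorphic_map_def)

lemma continuous_map_\<phi>: "continuous_map X euclidean \<phi>"
  using homeomorphic_map_\<phi> homeomorphic_imp_continuous_map continuous_map_into_fulltopology by blast

lemma compact_\<phi>_image: "compactin X C \<Longrightarrow> compact (\<phi> ` C)"
  using image_compactin[OF _ continuous_map_\<phi>] by simp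

text \<open>The non-empty compact sets inside \<open>V\<close> form an open subset of the
  hyperspace, and its preimage under the continuous map of (A2) is the set in question.\<close>

lemma upset_usc:
  assumes rs: "r \<in> R" "s \<in> R" "r < s" and V: "openin (stratum_space X \<mu> s) V"
  shows "openin (stratum_space X \<mu> r) {x \<in> stratum X \<mu> r. upset_in X P \<mu> s {x} \<subseteq> V}"
proof -
  let ?M = "stratum_space X \<mu> s" and ?d = "\<lambda>y z. length_dist (\<phi> ` stratum X \<mu> s) (\<phi> y) (\<phi> z)"
  define \<V> where "\<V> = {C. compactin ?M C \<and> C \<noteq> {} \<and> C \<subseteq> V}"
  obtain V' where V': "openin X V'" "V = V' \<inter> stratum X \<mu> s"
    using V by (auto simp: openin_subtopology)
  have "openin (top_of_set (\<phi> ` topspace X)) (\<phi> ` V')"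
    using homeomorphic_map_openness[OF homeomorphic_map_\<phi>] V'(1) openin_subset by blast
  then obtain O' where O': "open O'" "\<phi> ` V' = \<phi> ` topspace X \<inter> O'"
    by (auto simp: openin_open)
  have V_iff: "y \<in> V \<longleftrightarrow> \<phi> y \<in> O'" if "y \<in> stratum X \<mu> s" for y
  proof -
    have y: "y \<in> topspace X" using that stratum_subset by blast
    have "y \<in> V' \<longleftrightarrow> \<phi> y \<in> \<phi> ` V'"
      using inj_on_image_mem_iff[OF inj_\<phi> y openin_subset[OF V'(1)]] by simp
    then show ?thesis using O'(2) V'(2) that y by auto
  qed
  have "openin (compact_hyperspace ?M ?d) \<V>"
    unfolding openin_compact_hyperspace
  proof (intro conjI ballI)
    fix C assume C: "C \<in> \<V>"
    then have "compact (\<phi> ` C)" "C \<subseteq> stratum X \<mu> s"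
      by (auto simp: \<V>_def compactin_subtopology intro: compact_\<phi>_image)
    moreover have "\<phi> ` C \<subseteq> O'" using C V_iff \<open>C \<subseteq> stratum X \<mu> s\<close> by (auto simp: \<V>_def)
    \<comment> \<open>By compactness one \<open>\<epsilon>\<close> serves all of \<open>C\<close>:
      each point of a set \<open>D\<close> at Hausdorff distance below it is Euclidean
      \<open>\<epsilon>\<close>-close to some point of \<open>C\<close>, hence in
      \<open>V\<close>.\<close>
    ultimately obtain \<epsilon> where \<epsilon>: "\<epsilon> > 0" "(\<Union>x\<in>\<phi> ` C. ball x \<epsilon>) \<subseteq> O'"
      using compact_subset_open_imp_ball_epsilon_subset O'(1) by metis
    have "D \<in> \<V>" if D: "compactin ?M D" "D \<noteq> {}" "hausdorff_dist ?d C D < ennreal \<epsilon>" for D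
    proof -
      have "e \<in> V" if e: "e \<in> D" for e
      proof -
        have "(INF c\<in>C. ?d c e) \<le> (SUP e\<in>D. INF c\<in>C. ?d c e)" using e by (rule SUP_upper)
        also have "\<dots> \<le> hausdorff_dist ?d C D" by (simp add: hausdorff_dist_def)
        also have "\<dots> < \<epsilon>" by (rule D(3))
        finally obtain c where c: "c \<in> C" "?d c e < ennreal \<epsilon>" by (auto simp: INF_less_iff)
        have "ennreal (dist (\<phi> c) (\<phi> e)) < ennreal \<epsilon>"
          using dist_le_length_dist c(2) by (rule le_less_trans)
        then have "\<phi> e \<in> ball (\<phi> c) \<epsilon>" using \<epsilon>(1) by (simp add: ennreal_less_iff)
        then have "\<phi> e \<in> O'" using \<epsilon>(2) c(1) by blast
        then show "e \<in> V" using V_iff e D(1) by (auto simp: compactin_subtopology)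
      qed
      then show ?thesis using D by (auto simp: \<V>_def)
    qed
    then show "\<exists>\<epsilon>>0. \<forall>D. compactin ?M D \<and> D \<noteq> {} \<and> hausdorff_dist ?d C D < \<epsilon> \<longrightarrow> D \<in> \<V>"
      using \<epsilon>(1) by (intro exI[of _ "ennreal \<epsilon>"]) auto
  qed (auto simp: \<V>_def)
  from openin_continuous_map_preimage[OF A2[OF rs] this]
  have "openin (stratum_space X \<mu> r) {x \<in> stratum X \<mu> r. upset_in X P \<mu> s {x} \<in> \<V>}"
    unfolding topspace_stratum_space .
  moreover have "upset_in X P \<mu> s {x} \<in> \<V> \<longleftrightarrow> upset_in X P \<mu> s {x} \<subseteq> V" if "x \<in> stratum X \<mu> r" for x
    using A1[OF rs that] by (auto simp: \<V>_def)
  ultimately show ?thesis by (simp cong: conj_cong)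
qed

lemma closed_\<phi>_stratum: "r \<in> R \<Longrightarrow> closed (\<phi> ` stratum X \<mu> r)"
  using stratum_polyhedron[of r] by (auto simp: pl_polyhedron_def rectilinear_complex_def)

lemma closed_other_strata: "closed (\<phi> ` (topspace X - stratum X \<mu> r))"
proof -
  have "\<phi> ` (topspace X - stratum X \<mu> r) = (\<Union>r'\<in>R - {r}. \<phi> ` stratum X \<mu> r')"
    using mirror_in by (auto simp: stratum_def)
  then show ?thesis using finite_R closed_\<phi>_stratum by auto
qed

lemma map_prod_\<phi>_Times:
  assumes "P' \<subseteq> topspace X \<times> topspace X" "S \<subseteq> topspace X" "T \<subseteq> topspace X"
  shows "map_prod \<phi> \<phi> ` (P' \<inter> S \<times> T) = map_prod \<phi> \<phi> ` P' \<inter> \<phi> ` S \<times> \<phi> ` T"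
proof -
  have "inj_on (map_prod \<phi> \<phi>) (topspace X \<times> topspace X)"
    using map_prod_inj_on[OF inj_\<phi> inj_\<phi>] .
  then have "map_prod \<phi> \<phi> ` (P' \<inter> S \<times> T) = map_prod \<phi> \<phi> ` P' \<inter> map_prod \<phi> \<phi> ` (S \<times> T)"
    using assms by (intro inj_on_image_Int) auto
  then show ?thesis by (simp add: map_prod_image)
qed

lemma P_subset: "P \<subseteq> topspace X \<times> topspace X"
  using closedin_subset[OF closed_order] by simp

section \<open>The graph of the order between two strata\<close>

definition "order_between r s = P \<inter> stratum X \<mu> r \<times> stratum X \<mu> s"

lemma order_between_image:
  "map_prod \<phi> \<phi> ` order_between r s = map_prod \<phi> \<phi> ` P \<inter> \<phi> ` stratum X \<mu> r \<times> \<phi> ` stratum X \<mu> s"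
  unfolding order_between_def by (intro map_prod_\<phi>_Times P_subset stratum_subset)

text \<open>The graph between two strata is open and closed in the whole order relation, so each simplex
  of a triangulation of the relation, being connected, is contained in it or disjoint from it.\<close>

lemma finite_convex_union_order_between:
  assumes "r \<in> R" "s \<in> R"
  shows "finite_convex_union (map_prod \<phi> \<phi> ` order_between r s \<inter> cball 0 k)"
proof -
  let ?E = "map_prod \<phi> \<phi> ` order_between r s"
  obtain L where L: "rectilinear_complex L" "\<Union>L = map_prod \<phi> \<phi> ` P"
    using order_subpolyhedron by (auto simp: subpolyhedron_def)
  define F where "F = \<phi> ` stratum X \<mu> r \<times> \<phi> ` stratum X \<mu> s"
  \<comment> \<open>Pairs with at least one entry in another stratum: closed, disjoint from
    \<open>F\<close>, and together with \<open>F\<close> covering the relation.\<close>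
  define F' where "F' = \<phi> ` (topspace X - stratum X \<mu> r) \<times> UNIV \<union> UNIV \<times> \<phi> ` (topspace X - stratum X \<mu> s)"
  have F: "closed F" "closed F'"
    unfolding F_def F'_def
    using closed_\<phi>_stratum[OF assms(1)] closed_\<phi>_stratum[OF assms(2)] closed_other_strata
    by (auto intro!: closed_Times)
  have cover: "map_prod \<phi> \<phi> ` P \<subseteq> F \<union> F'"
    using P_subset by (auto simp: F_def F'_def)
  have disj: "F \<inter> F' = {}"
  proof -
    have "\<phi> ` stratum X \<mu> q \<inter> \<phi> ` (topspace X - stratum X \<mu> q) = {}" for q
      using inj_on_image_Int[OF inj_\<phi> stratum_subset[of q], of "topspace X - stratum X \<mu> q"]
      by (simp flip: image_Int)
    then show ?thesis unfolding F_def F'_def by auto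
  qed
  have E: "?E = map_prod \<phi> \<phi> ` P \<inter> F" by (simp add: order_between_image F_def)
  have cell: "S \<inter> F = S \<or> S \<inter> F = {}" if "S \<in> L" for S
  proof -
    have "connected S" using rectilinear_complex_cell(2)[OF L(1) that] convex_connected by blast
    moreover have "S \<subseteq> F \<union> F'" using Union_upper[OF that] cover unfolding L(2) by (rule order_trans)
    ultimately have "F \<inter> S = {} \<or> F' \<inter> S = {}"
      using connected_closedD[of S F F'] F disj by simp
    then show ?thesis using \<open>S \<subseteq> F \<union> F'\<close> by blast
  qed
  \<comment> \<open>Only finitely many simplices meet the ball, and by \<open>cell\<close>
    intersecting with \<open>F\<close> keeps a simplex whole or empties it.\<close>
  let ?\<C> = "(\<lambda>S. S \<inter> F \<inter> cball 0 k) ` {S \<in> L. S \<inter> cball 0 k \<noteq> {}}"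
  have "finite ?\<C>"
    using rectilinear_complex_locally_finite[OF L(1) compact_cball] by simp
  moreover have "compact C \<and> convex C" if C: "C \<in> ?\<C>" for C
  proof -
    obtain S where S: "S \<in> L" "C = S \<inter> F \<inter> cball 0 k" using C by blast
    then show ?thesis
      using cell[OF S(1)] rectilinear_complex_cell[OF L(1) S(1)]
      by (metis compact_Int compact_cball compact_empty convex_Int convex_cball convex_empty)
  qed
  ultimately have "finite_convex_union (\<Union>?\<C>)" by (rule finite_convex_unionI)
  moreover have "\<Union>?\<C> = ?E \<inter> cball 0 k" unfolding E L(2)[symmetric] by blast
  ultimately show ?thesis by simp
qed

text \<open>The points whose up-set lies in the ball of radius \<open>n\<close> form increasing open
  sets by upper semicontinuity. They cover \<open>A\<close> because single up-sets are compact, so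
  one of them contains \<open>A\<close>.\<close>

lemma bounded_upset:
  assumes rs: "r \<in> R" "s \<in> R" "r < s" and A: "compactin X A" "A \<subseteq> stratum X \<mu> r"
  shows "bounded (\<phi> ` upset_in X P \<mu> s A)"
proof -
  define V where "V n = {y \<in> stratum X \<mu> s. \<phi> y \<in> ball 0 (real n)}" for n
  define U where "U n = {x \<in> stratum X \<mu> r. upset_in X P \<mu> s {x} \<subseteq> V n}" for n
  have V: "openin (stratum_space X \<mu> s) (V n)" for n
    using openin_continuous_map_preimage[OF continuous_map_from_subtopology[OF continuous_map_\<phi>],
        of "ball 0 (real n)" "stratum X \<mu> s", unfolded topspace_stratum_space]
    unfolding V_def by simp
  have U: "openin (stratum_space X \<mu> r) (U n)" for n
    unfolding U_def by (rule upset_usc[OF rs V])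
  have mono: "U m \<subseteq> U n" if "m \<le> n" for m n
  proof -
    have "V m \<subseteq> V n" using that by (auto simp: V_def)
    then show ?thesis unfolding U_def by blast
  qed
  have "\<exists>n. x \<in> U n" if "x \<in> A" for x
  proof -
    have x: "x \<in> stratum X \<mu> r" using that A(2) by blast
    have "compactin X (upset_in X P \<mu> s {x})"
      using A1[OF rs x] by (simp add: compactin_subtopology)
    then have "bounded (\<phi> ` upset_in X P \<mu> s {x})"
      using compact_\<phi>_image compact_imp_bounded by blast
    then obtain b where b: "\<And>y. y \<in> upset_in X P \<mu> s {x} \<Longrightarrow> norm (\<phi> y) \<le> b"
      by (auto simp: bounded_iff)
    obtain n where "b < real n" using reals_Archimedean2 by blast
    then have "y \<in> V n" if "y \<in> upset_in X P \<mu> s {x}" for y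
      using b[OF that] that by (simp add: V_def upset_in_def)
    then have "x \<in> U n" unfolding U_def using x by blast
    then show ?thesis ..
  qed
  then have "A \<subseteq> \<Union>(range U)" by blast
  moreover have "compactin (stratum_space X \<mu> r) A" using A by (simp add: compactin_subtopology)
  moreover have "openin (stratum_space X \<mu> r) W" if "W \<in> range U" for W
    using U that by auto
  ultimately have "\<exists>\<F>. finite \<F> \<and> \<F> \<subseteq> range U \<and> A \<subseteq> \<Union>\<F>"
    by (intro compactinD)
  then obtain \<F> where "finite \<F>" "\<F> \<subseteq> range U" "A \<subseteq> \<Union>\<F>" by (elim exE conjE)
  then obtain N where N: "finite N" "\<F> = U ` N" by (meson finite_subset_image)
  obtain n where "N \<subseteq> {..n}" using N(1) finite_nat_iff_bounded_le[of N] by auto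
  then have "\<Union>\<F> \<subseteq> U n" unfolding N(2) using mono by (intro UN_least) auto
  with \<open>A \<subseteq> \<Union>\<F>\<close> have "A \<subseteq> U n" by (rule order_trans)
  then have "upset_in X P \<mu> s A \<subseteq> V n"
    unfolding U_def upset_in_def by blast
  then have "\<phi> ` upset_in X P \<mu> s A \<subseteq> ball 0 (real n)"
    unfolding V_def by blast
  then show ?thesis using bounded_ball bounded_subset by blast
qed

lemma closedin_order_between:
  "closedin (prod_topology (stratum_space X \<mu> r) (stratum_space X \<mu> s)) (order_between r s)"
proof -
  have "closedin (subtopology (prod_topology X X) (stratum X \<mu> r \<times> stratum X \<mu> s)) (order_between r s)"
    unfolding closedin_subtopology order_between_def
    by (intro exI[of _ P] conjI closed_order refl)
  then show ?thesis by (simp add: subtopology_Times del: subtopology_topspace)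
qed

text \<open>The deformation is built in Euclidean space for the images of \<open>Q\<close> and
  \<open>T\<close> under \<open>map_prod \<phi> \<phi>\<close>, where the PL hypotheses give ENRs,
  and is carried back by the inverse of the embedding.\<close>

lemma join_deformation_exists:
  fixes A
  assumes rs: "r \<in> R" "s \<in> R" "r < s" and A: "compactin X A" "A \<subseteq> stratum X \<mu> r"
    and poly: "subpolyhedron (\<phi> ` stratum X \<mu> r) (\<phi> ` A)"
  shows "\<exists>D l. join_deformation (stratum_space X \<mu> r) (stratum_space X \<mu> s) (order_between r s) A D l"
proof -
  let ?f = "map_prod \<phi> \<phi>"
  define E where "E = order_between r s"
  define B where "B = E `` A"
  define Q where "Q = E \<inter> UNIV \<times> B"
  define T where "T = E \<inter> A \<times> UNIV"
  let ?XX = "prod_topology (stratum_space X \<mu> r) (stratum_space X \<mu> s)"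
  have E_sub: "E \<subseteq> stratum X \<mu> r \<times> stratum X \<mu> s" by (auto simp: E_def order_between_def)
  have E_top: "E \<subseteq> topspace X \<times> topspace X" using E_sub stratum_subset by blast
  have B_eq: "B = upset_in X P \<mu> s A"
    using A(2) by (auto simp: B_def E_def order_between_def upset_in_def)
  have fibre: "E `` {x} = upset_in X P \<mu> s {x}" if "x \<in> stratum X \<mu> r" for x
    using that by (auto simp: E_def order_between_def upset_in_def)
  have A_top: "A \<subseteq> topspace X" and B_top: "B \<subseteq> topspace X"
    using A(2) E_sub stratum_subset by (auto simp: B_def)
  have TQ: "T \<subseteq> Q" by (auto simp: T_def Q_def B_def)
  have f_T: "?f ` T = ?f ` E \<inter> \<phi> ` A \<times> UNIV"
  proof -
    have "T = E \<inter> A \<times> topspace X" using E_top by (auto simp: T_def)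
    then have "?f ` T = ?f ` E \<inter> \<phi> ` A \<times> \<phi> ` topspace X"
      using map_prod_\<phi>_Times[OF E_top A_top order_refl] by simp
    then show ?thesis using E_top by auto
  qed
  have f_Q: "?f ` Q = ?f ` E \<inter> UNIV \<times> \<phi> ` B"
  proof -
    have "Q = E \<inter> topspace X \<times> B" using E_top by (auto simp: Q_def)
    then have "?f ` Q = ?f ` E \<inter> \<phi> ` topspace X \<times> \<phi> ` B"
      using map_prod_\<phi>_Times[OF E_top order_refl B_top] by simp
    then show ?thesis using E_top by auto
  qed
  have "bounded (\<phi> ` A \<times> \<phi> ` B)"
    using bounded_upset[OF rs A] compact_imp_bounded[OF compact_\<phi>_image[OF A(1)]]
    unfolding B_eq by (rule bounded_Times[rotated])
  moreover have "?f ` T \<subseteq> \<phi> ` A \<times> \<phi> ` B" by (auto simp: T_def B_def)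
  ultimately have "bounded (?f ` T)" using bounded_subset by blast
  then obtain k where k: "?f ` T \<subseteq> ball 0 k"
    using bounded_subset_ballD by blast
  have fA: "finite_convex_union (\<phi> ` A)"
  proof -
    obtain L where "rectilinear_complex L" "\<Union>L = \<phi> ` A"
      using poly by (auto simp: subpolyhedron_def)
    then show ?thesis
      using finite_convex_union_polyhedron[of L] compact_\<phi>_image[OF A(1)] by simp
  qed
  have E_cball: "finite_convex_union (?f ` E \<inter> cball 0 k)"
    unfolding E_def by (rule finite_convex_union_order_between[OF rs(1,2)])
  \<comment> \<open>Cutting by the ball changes nothing as \<open>T\<close> lies inside it; the
    second factor becomes a ball because a coordinate is no longer than its pair.\<close>
  have "?f ` T = (?f ` E \<inter> cball 0 k) \<inter> \<phi> ` A \<times> cball 0 k"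
  proof -
    have "M \<inter> N \<times> UNIV = (M \<inter> cball 0 k) \<inter> N \<times> cball 0 k"
      if "M \<inter> N \<times> UNIV \<subseteq> cball 0 k" for M :: "('e \<times> 'e) set" and N
      using that norm_snd_le order_trans by (fastforce simp: subset_iff)
    then show ?thesis
      using order_trans[OF k ball_subset_cball] unfolding f_T by metis
  qed
  then have fT: "finite_convex_union (?f ` T)"
    by (simp only:) (intro finite_convex_union_Int finite_convex_union_Times E_cball fA finite_convex_union_cball)
  \<comment> \<open>Every point of \<open>B\<close> is above a point of \<open>A\<close>, so
    \<open>B\<close> inherits its finite convex decomposition from \<open>T\<close> by a linear
    projection.\<close>
  have "snd ` ?f ` T = \<phi> ` B" by (force simp: T_def B_def)
  then have fB: "finite_convex_union (\<phi> ` B)"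
    using finite_convex_union_linear_image[OF fT, of snd] by (simp add: linear_snd)
  have "?f ` Q \<inter> cball 0 k = (?f ` E \<inter> cball 0 k) \<inter> cball 0 k \<times> \<phi> ` B"
  proof -
    have "M \<inter> UNIV \<times> N \<inter> cball 0 k = (M \<inter> cball 0 k) \<inter> cball 0 k \<times> N"
      for M :: "('e \<times> 'e) set" and N
      using norm_fst_le order_trans by (fastforce simp: subset_iff)
    then show ?thesis unfolding f_Q .
  qed
  then have fQ: "finite_convex_union (?f ` Q \<inter> cball 0 k)"
    by (simp only:) (intro finite_convex_union_Int finite_convex_union_Times E_cball fB finite_convex_union_cball)
  \<comment> \<open>The auxiliary ENR is the part of \<open>Q\<close> in the closed ball; the open
    ball of the same radius is the neighbourhood of \<open>T\<close> in which it agrees with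
    \<open>Q\<close>.\<close>
  obtain D' l' where D': "continuous_on (?f ` Q \<times> {0..1::real}) D'" "D' \<in> ?f ` Q \<times> {0..1} \<rightarrow> ?f ` Q"
    and D'_0: "\<And>z. z \<in> ?f ` Q \<Longrightarrow> D' (z, 0) = z"
    and D'_T: "\<And>z s. z \<in> ?f ` T \<Longrightarrow> s \<in> {0..1} \<Longrightarrow> D' (z, s) = z"
    and l': "continuous_on (?f ` Q) l'" "l' \<in> ?f ` Q \<rightarrow> {0..1::real}" "\<And>z. z \<in> ?f ` T \<Longrightarrow> l' z = 0"
    and D'_1: "\<And>z. z \<in> ?f ` Q \<Longrightarrow> l' z < 1 / 2 \<Longrightarrow> D' (z, 1) \<in> ?f ` T"
  proof (rule deformation_into_compact_ENR[OF finite_convex_union_compact[OF fT] finite_convex_union_ENR[OF fT]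
          image_mono[OF TQ] finite_convex_union_ENR[OF fQ] Int_lower1 open_ball k
          Int_mono[OF order_refl ball_subset_cball]], goal_cases)
    case (1 D l)
    show thesis by (rule that[of D l]; (rule 1; assumption))
  qed
  obtain \<psi> where \<psi>: "homeomorphic_maps X (top_of_set (\<phi> ` topspace X)) \<phi> \<psi>"
    using homeomorphic_map_\<phi> homeomorphic_map_maps by blast
  let ?g = "map_prod \<psi> \<psi>"
  have gf: "?g (?f z) = z" if "z \<in> topspace X \<times> topspace X" for z
    using that \<psi> by (auto simp: homeomorphic_maps_def)
  have Q_top: "Q \<subseteq> topspace X \<times> topspace X" using E_top by (auto simp: Q_def)
  have g_Q: "?g ` ?f ` Q = Q" and g_T: "?g ` ?f ` T = T"
    using gf Q_top TQ by (force simp: image_image)+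
  have XX: "?XX = subtopology (prod_topology X X) (stratum X \<mu> r \<times> stratum X \<mu> s)"
    by (simp add: subtopology_Times)
  have subQ: "subtopology ?XX Q = subtopology (prod_topology X X) Q"
    using E_sub by (auto simp: XX subtopology_subtopology Q_def intro!: arg_cong[of _ _ "subtopology _"])
  have cont_f: "continuous_map (subtopology ?XX Q) (top_of_set (?f ` Q)) ?f"
  proof (rule continuous_map_into_subtopology)
    have "continuous_map (prod_topology X X) (prod_topology euclidean euclidean) ?f"
      unfolding continuous_map_pairwise comp_def fst_map_prod snd_map_prod
      by (intro conjI continuous_map_compose[OF continuous_map_fst continuous_map_\<phi>, unfolded comp_def]
          continuous_map_compose[OF continuous_map_snd continuous_map_\<phi>, unfolded comp_def])
    then show "continuous_map (subtopology ?XX Q) euclidean ?f"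
      unfolding subQ by (simp add: continuous_map_from_subtopology)
  qed auto
  have cont_g: "continuous_map (top_of_set (?f ` Q)) (subtopology ?XX Q) ?g"
    unfolding subQ
  proof (rule continuous_map_into_subtopology)
    have \<psi>': "continuous_map (top_of_set (\<phi> ` topspace X)) X \<psi>"
      using \<psi> by (simp add: homeomorphic_maps_def)
    have "continuous_map (prod_topology (top_of_set (\<phi> ` topspace X)) (top_of_set (\<phi> ` topspace X)))
        (prod_topology X X) ?g"
      unfolding continuous_map_pairwise comp_def fst_map_prod snd_map_prod
      by (intro conjI continuous_map_compose[OF continuous_map_fst \<psi>', unfolded comp_def]
          continuous_map_compose[OF continuous_map_snd \<psi>', unfolded comp_def])
    then have "continuous_map (top_of_set (\<phi> ` topspace X \<times> \<phi> ` topspace X)) (prod_topology X X) ?g"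
      by simp
    then show "continuous_map (top_of_set (?f ` Q)) (prod_topology X X) ?g"
      by (rule continuous_map_from_subtopology_mono) (use Q_top in auto)
    show "?g \<in> topspace (top_of_set (?f ` Q)) \<rightarrow> Q"
      using g_Q by auto
  qed
  define D where "D = (\<lambda>(z, s). ?g (D' (?f z, s)))"
  have cont_D: "continuous_map (prod_topology (subtopology ?XX Q) (top_of_set {0..1})) (subtopology ?XX Q) D"
  proof -
    have "continuous_map (prod_topology (subtopology ?XX Q) (top_of_set {0..1::real}))
        (prod_topology (top_of_set (?f ` Q)) (top_of_set {0..1})) (\<lambda>(z, s). (?f z, s))"
      unfolding continuous_map_pairwise comp_def case_prod_unfold fst_conv snd_conv
      by (intro conjI continuous_map_compose[OF continuous_map_fst cont_f, unfolded comp_def] continuous_map_snd)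
    moreover have "continuous_map (prod_topology (top_of_set (?f ` Q)) (top_of_set {0..1::real})) (top_of_set (?f ` Q)) D'"
      using D' by simp
    ultimately have "continuous_map (prod_topology (subtopology ?XX Q) (top_of_set {0..1})) (subtopology ?XX Q)
        (?g \<circ> (D' \<circ> (\<lambda>(z, s). (?f z, s))))"
      by (intro continuous_map_compose[OF continuous_map_compose cont_g])
    moreover have "?g \<circ> (D' \<circ> (\<lambda>(z, s). (?f z, s))) = D" by (auto simp: D_def)
    ultimately show ?thesis by simp
  qed
  have "join_deformation (stratum_space X \<mu> r) (stratum_space X \<mu> s) E A D (l' \<circ> ?f)"
  proof (unfold_locales, unfold B_def[symmetric], unfold Q_def[symmetric] T_def[symmetric], unfold topspace_stratum_space)
    show "Hausdorff_space (stratum_space X \<mu> s)" using Hausdorff Hausdorff_space_subtopology by blast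
    show "closedin ?XX E" unfolding E_def by (rule closedin_order_between)
    show "A \<subseteq> stratum X \<mu> r" by (rule A(2))
    show "compactin (stratum_space X \<mu> s) (E `` {x})" "E `` {x} \<noteq> {}" if "x \<in> stratum X \<mu> r" for x
      using A1[OF rs that] fibre[OF that] by auto
    show "openin (stratum_space X \<mu> r) {x \<in> stratum X \<mu> r. E `` {x} \<subseteq> V}"
      if "openin (stratum_space X \<mu> s) V" for V
      using upset_usc[OF rs that] by (simp add: fibre cong: conj_cong)
    show "compactin ?XX T"
    proof -
      have "compactin (top_of_set (?f ` Q)) (?f ` T)"
        using finite_convex_union_compact[OF fT] TQ by (auto simp: compactin_subtopology)
      from image_compactin[OF this cont_g] show ?thesis
        by (simp add: g_T compactin_subtopology)
    qed
    show "continuous_map (prod_topology (subtopology ?XX Q) (top_of_set {0..1})) (subtopology ?XX Q) D"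
      by (rule cont_D)
    show "D (z, 0) = z" if "z \<in> Q" for z
      using that D'_0 gf Q_top by (auto simp: D_def)
    show "D (z, t) = z" if "z \<in> T" "t \<in> {0..1}" for z t
      using that D'_T[of "?f z" t] gf[of z] Q_top TQ by (auto simp: D_def)
    have "continuous_map (top_of_set (?f ` Q)) euclideanreal l'" using l'(1) by simp
    with cont_f show "continuous_map (subtopology ?XX Q) euclideanreal (l' \<circ> ?f)"
      by (rule continuous_map_compose)
    show "(l' \<circ> ?f) z \<in> {0..1}" if "z \<in> Q" for z using l'(2) that by auto
    show "(l' \<circ> ?f) z = 0" if "z \<in> T" for z using l'(3) that by auto
    show "D (z, 1) \<in> T" if "z \<in> Q" "(l' \<circ> ?f) z < 1 / 2" for z
    proof -
      have "D' (?f z, 1) \<in> ?f ` T" using D'_1[of "?f z"] that by simp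
      then have "?g (D' (?f z, 1)) \<in> ?g ` ?f ` T" by (rule imageI)
      then show ?thesis by (simp only: g_T D_def prod.case)
    qed
  qed
  then show ?thesis unfolding E_def by blast
qed

end

section \<open>Identification of the order complex and the preimage\<close>

text \<open>Parameter 0 reproduces the copy of \<open>A\<close>, and each point of \<open>B\<close>
  is the parameter 1 point over a pair in \<open>P\<close>, since it lies above a point of
  \<open>A\<close>. The rest therefore has parameters in \<open>{0<..1}\<close>.\<close>

lemma order_complex_eq:
  assumes Y1: "Y \<inter> stratum X \<mu> 1 = A" and Y2: "Y \<inter> stratum X \<mu> 2 = B"
    and above: "\<And>y. y \<in> B \<Longrightarrow> \<exists>x\<in>A. (x, y) \<in> P"
  shows "order_complex X P \<mu> Y =
    End1 ` A \<union> join_map ` ((P \<inter> A \<times> B) \<times> {0<..1})"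
proof -
  have disj: "x \<noteq> y" if "x \<in> A" "y \<in> B" for x y
    using that Y1 Y2 by (auto simp: stratum_def)
  have "p \<in> order_complex X P \<mu> Y \<longleftrightarrow> p \<in> End1 ` A \<or> p \<in> End2 ` B \<or>
      (\<exists>x y t. p = join_point x y t \<and> x \<in> A \<and> y \<in> B \<and> (x, y) \<in> P \<and> 0 \<le> t \<and> t \<le> 1)" for p
    unfolding order_complex_def Y1 Y2 using disj by auto
  moreover have "p \<in> join_map ` ((P \<inter> A \<times> B) \<times> {0<..1}) \<longleftrightarrow>
      (\<exists>x y t. p = join_point x y t \<and> x \<in> A \<and> y \<in> B \<and> (x, y) \<in> P \<and> 0 < t \<and> t \<le> 1)" for p
    by (auto simp: join_map_def image_iff Bex_def)
  moreover have "\<exists>x t. End2 y = join_point x y t \<and> x \<in> A \<and> y \<in> B \<and> (x, y) \<in> P \<and> 0 < t \<and> t \<le> 1" if "y \<in> B" for y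
    using above[OF that] that by (auto simp: join_point_def intro!: exI[of _ 1])
  moreover have "p \<in> End1 ` A" if "p = join_point x y t" "x \<in> A" "\<not> 0 < t" "0 \<le> t" for p x y t
    using that by (auto simp: join_point_def)
  ultimately show ?thesis
    by (intro set_eqI) (smt (verit, best) UnCI UnE imageE)
qed

theorem theorem4p14:
  fixes X :: "'a topology" and P :: "'a rel" and \<mu> :: "'a \<Rightarrow> nat"
    and \<phi> :: "'a \<Rightarrow> 'e::euclidean_space" and \<U> :: "nat \<Rightarrow> 'a set set"
    and A :: "'a set"
  assumes "geometric_M_poset X P {1, 2} \<mu> \<phi> \<U>"
    and "A \<subseteq> stratum X \<mu> 1"
    and "compactin X A"
    and "subpolyhedron (\<phi> ` stratum X \<mu> 1) (\<phi> ` A)"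
  shows "homotopy_equivalence_map
           (subtopology (order_complex_space X P \<mu>) (order_complex X P \<mu> (upset P A)))
           (subtopology (order_complex_space X P \<mu>) (comparison_preimage X P \<mu> (upset P A)))
           id"
proof -
  interpret geometric_M_poset X P "{1, 2}" \<mu> \<phi> \<U> by (rule assms(1))
  obtain D l where J: "join_deformation (stratum_space X \<mu> 1) (stratum_space X \<mu> 2) (order_between 1 2) A D l"
    using join_deformation_exists[of 1 2 A] assms by auto
  interpret J: join_deformation "stratum_space X \<mu> 1" "stratum_space X \<mu> 2" "order_between 1 2" A D l
    "order_between 1 2 `` A" "order_between 1 2 \<inter> UNIV \<times> order_between 1 2 `` A" "order_between 1 2 \<inter> A \<times> UNIV"
    by (fact J) simp_all
  let ?B = "order_between 1 2 `` A"
  have refl: "(x, x) \<in> P" if "x \<in> topspace X" for x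
    using that order by (simp add: partial_order_on_def preorder_on_def refl_on_def)
  \<comment> \<open>Distinct comparable points have distinct mirror values, so the up-set gains
    nothing new in the stratum of \<open>A\<close>.\<close>
  have up1: "upset P A \<inter> stratum X \<mu> 1 = A"
  proof -
    have "x = a" if "a \<in> A" "(a, x) \<in> P" "x \<in> stratum X \<mu> 1" for a x
      using mirror_strict[OF that(2)] that(3) subsetD[OF assms(2) that(1)] by (auto simp: stratum_def)
    moreover have "A \<subseteq> upset P A" using refl assms(2) by (auto simp: stratum_def)
    ultimately show ?thesis using assms(2) by blast
  qed
  have up2: "upset P A \<inter> stratum X \<mu> 2 = ?B"
    using assms(2) by (auto simp: order_between_def)
  have B2: "?B \<subseteq> stratum X \<mu> 2" using up2 by blast
  have top1: "topspace X \<inter> stratum X \<mu> r = stratum X \<mu> r" for r by (auto simp: stratum_def)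
  have S: "order_complex X P \<mu> (upset P A) = J.S"
  proof -
    have "order_complex X P \<mu> (upset P A) = End1 ` A \<union> join_map ` ((P \<inter> A \<times> ?B) \<times> {0<..1})"
      by (rule order_complex_eq[OF up1 up2]) (auto simp: order_between_def)
    moreover have "P \<inter> A \<times> ?B = order_between 1 2 \<inter> A \<times> UNIV"
      using assms(2) by (auto simp: order_between_def)
    ultimately show ?thesis by (simp only: J.S_def)
  qed
  have mem: "p \<in> order_complex X P \<mu> (topspace X) \<longleftrightarrow>
      p \<in> End1 ` stratum X \<mu> 1 \<or> p \<in> End2 ` stratum X \<mu> 2 \<or>
      (\<exists>x y t. p = join_point x y t \<and> (x, y) \<in> order_between 1 2 \<and> 0 \<le> t \<and> t \<le> 1)" for p
  proof -
    have "x \<noteq> y" if "x \<in> stratum X \<mu> 1" "y \<in> stratum X \<mu> 2" for x y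
      using that by (auto simp: stratum_def)
    then show ?thesis
      unfolding order_complex_def top1 order_between_def by auto
  qed
  have cmp: "comparison_map (join_point x y t) = (if t = 0 then x else y)" for x y t
    by (simp add: join_point_def)
  have W: "comparison_preimage X P \<mu> (upset P A) = J.W"
  proof (intro equalityI subsetI)
    fix p assume "p \<in> comparison_preimage X P \<mu> (upset P A)"
    then have p: "p \<in> order_complex X P \<mu> (topspace X)" "comparison_map p \<in> upset P A"
      by (auto simp: comparison_preimage_def)
    \<comment> \<open>Parameter 0 is absorbed by the first case, leaving a positive parameter in the
      third, as in \<open>W0\<close>.\<close>
    from p(1)[unfolded mem] consider x where "p = End1 x" "x \<in> stratum X \<mu> 1"
      | y where "p = End2 y" "y \<in> stratum X \<mu> 2"
      | x y t where "p = join_point x y t" "(x, y) \<in> order_between 1 2" "0 < t" "t \<le> 1"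
    proof -
      have "join_point x y 0 = End1 x" for x y :: 'a by (simp add: join_point_def)
      moreover have "x \<in> stratum X \<mu> 1" if "(x, y) \<in> order_between 1 2" for x y
        using that by (simp add: order_between_def)
      ultimately show thesis using p(1)[unfolded mem] that by (metis imageE less_eq_real_def)
    qed
    then show "p \<in> J.W"
    proof cases
      case 1
      then have "x \<in> A" using p(2) up1 by auto
      then show ?thesis using 1 unfolding J.W_def by blast
    next
      case 2
      then have "y \<in> ?B" using p(2) up2 by auto
      \<comment> \<open>A bare point \<open>y\<close> of \<open>B\<close> is placed in
        \<open>W0\<close> as the parameter 1 point over a pair \<open>(a, y)\<close>.\<close>
      then obtain a where "a \<in> A" "(a, y) \<in> order_between 1 2" by blast
      then have "((a, y), 1::real) \<in> (order_between 1 2 \<inter> UNIV \<times> ?B) \<times> {0<..1}" by auto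
      moreover have "p = join_map ((a, y), 1)" using 2 by (simp add: join_map_def join_point_def)
      ultimately show ?thesis unfolding J.W_def J.W0_def by blast
    next
      case 3
      then have "y \<in> ?B" using p(2) up2 by (auto simp: cmp order_between_def)
      then have "((x, y), t) \<in> (order_between 1 2 \<inter> UNIV \<times> ?B) \<times> {0<..1}" using 3 by auto
      moreover have "p = join_map ((x, y), t)" using 3 by (simp add: join_map_def)
      ultimately show ?thesis unfolding J.W_def J.W0_def by blast
    qed
  next
    fix p assume p: "p \<in> J.W"
    consider x where "p = End1 x" "x \<in> A"
      | x y t where "p = join_point x y t" "(x, y) \<in> order_between 1 2" "y \<in> ?B" "0 < t" "t \<le> 1"
    proof -
      from p consider "p \<in> End1 ` A" | w where "w \<in> (order_between 1 2 \<inter> UNIV \<times> ?B) \<times> {0<..1}" "p = join_map w"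
        unfolding J.W_def J.W0_def by blast
      then show thesis
      proof cases
        case 1
        then show thesis using that(1) by blast
      next
        case 2
        then show thesis
          by (intro that(2)[of "fst (fst w)" "snd (fst w)" "snd w"]) (auto simp: join_map_def)
      qed
    qed
    then show "p \<in> comparison_preimage X P \<mu> (upset P A)"
    proof cases
      case 1
      then show ?thesis
        using assms(2) up1 unfolding comparison_preimage_def mem_Collect_eq mem by auto
    next
      case 2
      have "comparison_map p \<in> upset P A" using 2 up2 by (auto simp: cmp)
      moreover have "p \<in> order_complex X P \<mu> (topspace X)"
        unfolding mem using 2 by (intro disjI2 exI[of _ x] exI[of _ y] exI[of _ t]) auto
      ultimately show ?thesis by (simp add: comparison_preimage_def)
    qed
  qed
  \<comment> \<open>Both sets lie in the order complex, so they carry the same subspace topology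
    from it as from the join.\<close>
  have "J.S \<subseteq> J.W" using J.S_subset_W .
  moreover have "J.W \<subseteq> order_complex X P \<mu> (topspace X)"
    unfolding W[symmetric] by (auto simp: comparison_preimage_def)
  ultimately have "subtopology (order_complex_space X P \<mu>) J.S = subtopology J.J J.S"
    "subtopology (order_complex_space X P \<mu>) J.W = subtopology J.J J.W"
    by (auto simp: order_complex_space_def subtopology_subtopology Int_absorb1)
  then show ?thesis
    unfolding S W using J.homotopy_equivalence_map_S_W by simp
qed

end
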